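(* Let $h\in SL(2,\mathbf{Z})$ be hyperbolic. Then $h$ is stably mixing if and only if $h$ is not conjugate to its inverse $h^{-1}$ in $SL(2,\mathbf{Z})$.
   Context: An element $h\in SL(2,\mathbf{Z})$ is hyperbolic if $|\operatorname{trace}(h)|>2$. The group $SL(2,\mathbf{Z})$ acts on the torus $\mathbf{T}=\mathbf{R}^2/\mathbf{Z}^2$ by its linear action. $\mathbf{N}$ denotes the positive integers. For a sequence $(f^{(n)})_{n\in\mathbf{N}}$ in $SL(2,\mathbf{Z})$ and $F_1,F_2\in L^2(\mathbf{T})$, the time correlation function is $$C(F_1,F_2;f^{(n)})=\int_{\mathbf{T}}F_1(f^{(n)}(x))F_2(x)\,dx-\int_{\mathbf{T}}F_1(x)\,dx\int_{\mathbf{T}}F_2(x)\,dx.$$ The sequence (sequential system) $(f^{(n)})$ is mixing if $C(F_1,F_2;f^{(n)})\to 0$ as $n\to\infty$ for all $F_1,F_2\in L^2(\mathbf{T})$. An element $h\in SL(2,\mathbf{Z})$ is stably mixing if for every sequence of kicks $\Phi=\{\phi_i\}_{i\in\mathbf{N}}\subset SL(2,\mathbf{Z})$ such that the sequence $\operatorname{trace}(\phi_i)$ is bounded, there exists $t_0=t_0(\Phi)$ such that for every $t\in\mathbf{N}$ with $t>t_0$ the sequential system $f^{(n)}(t)=\phi_n h^t\cdots\phi_2 h^t\phi_1 h^t$, $n\in\mathbf{N}$, is mixing. *)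

theory Defs
  imports "HOL-Analysis.Analysis"
begin

definition SL2Z :: "(int^2^2) set" where
  "SL2Z = {A. det A = 1}"

definition hyperbolic :: "int^2^2 \<Rightarrow> bool" where
  "hyperbolic A \<longleftrightarrow> \<bar>trace A\<bar> > 2"

definition conjugate_SL2Z :: "int^2^2 \<Rightarrow> int^2^2 \<Rightarrow> bool" where
  "conjugate_SL2Z A B \<longleftrightarrow> (\<exists>g\<in>SL2Z. g ** A ** matrix_inv g = B)"

(* The overloaded powers and products on vec are componentwise, hence the explicit matrix power. *)
primrec mat_pow :: "int^2^2 \<Rightarrow> nat \<Rightarrow> int^2^2" where
  "mat_pow A 0 = mat 1"
| "mat_pow A (Suc n) = A ** mat_pow A n"

definition lattice_equiv :: "real^2 \<Rightarrow> real^2 \<Rightarrow> bool" where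
  "lattice_equiv x y \<longleftrightarrow> (\<forall>i. x $ i - y $ i \<in> \<int>)"

lemma equivp_lattice_equiv: "equivp lattice_equiv"
proof (rule equivpI)
  show "reflp lattice_equiv"
    by (simp add: reflp_def lattice_equiv_def)
  show "symp lattice_equiv"
    unfolding symp_def lattice_equiv_def by (metis Ints_minus minus_diff_eq)
  show "transp lattice_equiv"
    unfolding transp_def lattice_equiv_def by (metis Ints_add diff_add_cancel add_diff_eq)
qed

quotient_type torus = "real^2" / lattice_equiv
  by (rule equivp_lattice_equiv)

lift_definition torus_of :: "real^2 \<Rightarrow> torus" is "\<lambda>x. x" .

lift_definition torus_act :: "int^2^2 \<Rightarrow> torus \<Rightarrow> torus"
  is "\<lambda>A x. map_matrix real_of_int A *v x"
proof -
  fix A :: "int^2^2" and x y :: "real^2"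
  assume "lattice_equiv x y"
  moreover have "(map_matrix real_of_int A *v x) $ i - (map_matrix real_of_int A *v y) $ i
      = (\<Sum>j\<in>UNIV. real_of_int (A $ i $ j) * (x $ j - y $ j))" for i
    by (simp add: matrix_vector_mult_def sum_subtractf right_diff_distrib)
  ultimately show "lattice_equiv (map_matrix real_of_int A *v x) (map_matrix real_of_int A *v y)"
    unfolding lattice_equiv_def by (auto intro!: Ints_sum Ints_mult)
qed

definition unit_cell :: "(real^2) set" where
  "unit_cell = {x. \<forall>i. 0 \<le> x $ i \<and> x $ i < 1}"

(* Normalised Lebesgue (Haar) measure on the Borel sets of the torus for the quotient topology:
   the push-forward of Lebesgue measure on a fundamental domain. *)
definition torus_measure :: "torus measure" where
  "torus_measure = distr (restrict_space lborel unit_cell)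
     (sigma UNIV {B. torus_of -` B \<in> sets borel}) torus_of"

lemma space_torus_measure [simp]: "space torus_measure = UNIV"
  by (simp add: torus_measure_def)

lemma sets_torus_measure: "B \<in> sets torus_measure \<longleftrightarrow> torus_of -` B \<in> sets borel"
proof -
  have "sigma_algebra UNIV {B. torus_of -` B \<in> sets borel}"
    by (rule sigma_algebra_iff2[THEN iffD2])
       (auto simp: vimage_UN Compl_eq_Diff_UNIV[symmetric] vimage_Compl borel_comp)
  then have "sigma_sets UNIV {B. torus_of -` B \<in> sets borel} = {B. torus_of -` B \<in> sets borel}"
    by (rule sigma_algebra.sigma_sets_eq)
  then show ?thesis
    by (simp add: torus_measure_def)
qed

definition L2_torus :: "(torus \<Rightarrow> complex) set" where
  "L2_torus = {F \<in> borel_measurable torus_measure. integrable torus_measure (\<lambda>x. (norm (F x))\<^sup>2)}"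

definition time_correlation ::
    "(torus \<Rightarrow> complex) \<Rightarrow> (torus \<Rightarrow> complex) \<Rightarrow> int^2^2 \<Rightarrow> complex" where
  "time_correlation F1 F2 A =
     (\<integral>x. F1 (torus_act A x) * F2 x \<partial>torus_measure)
     - (\<integral>x. F1 x \<partial>torus_measure) * (\<integral>x. F2 x \<partial>torus_measure)"

definition mixing :: "(nat \<Rightarrow> int^2^2) \<Rightarrow> bool" where
  "mixing f \<longleftrightarrow> (\<forall>F1\<in>L2_torus. \<forall>F2\<in>L2_torus. (\<lambda>n. time_correlation F1 F2 (f n)) \<longlonglongrightarrow> 0)"

(* Kicks are indexed from 1; the value at 0 of a kick sequence is never used. *)
primrec kicked_system :: "(nat \<Rightarrow> int^2^2) \<Rightarrow> int^2^2 \<Rightarrow> nat \<Rightarrow> nat \<Rightarrow> int^2^2" where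
  "kicked_system \<phi> h t 0 = mat 1"
| "kicked_system \<phi> h t (Suc n) = \<phi> (Suc n) ** mat_pow h t ** kicked_system \<phi> h t n"

definition stably_mixing :: "int^2^2 \<Rightarrow> bool" where
  "stably_mixing h \<longleftrightarrow>
     (\<forall>\<phi>. (\<forall>i\<ge>1. \<phi> i \<in> SL2Z) \<and> (\<exists>B. \<forall>i\<ge>1. \<bar>trace (\<phi> i)\<bar> \<le> B) \<longrightarrow>
        (\<exists>t0. \<forall>t>t0. mixing (kicked_system \<phi> h t)))"

end

theory Submission
  imports Defs
begin

text \<open>Suppose first that \<open>h\<close> is not conjugate to its inverse. The proof finds a quasimorphism \<open>q\<close> on
\<open>SL(2,\<int>)\<close> that is bounded on every set of bounded trace but grows linearly along the powers of \<open>h\<close>.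
Once \<open>t\<close> is large, the gain \<open>q (h^t)\<close> beats the bounded loss caused by a kick, so \<open>q\<close> increases by at
least one at every step along the products \<open>f\<^sup>(\<^sup>n\<^sup>)\<close>. This drift forces mixing, because \<open>q\<close> is bounded on the
matrices that carry one given lattice vector to another.

The quasimorphism counts subwords (Brooks). Up to signs and factors \<open>S\<close> at both ends, every matrix is
a unique product of the letters \<open>(1 1; 0 1)\<close> and \<open>(1 0; 1 1)\<close> (\<open>spells_exists\<close>, \<open>spells_unique\<close>); this
is the normal form in the free product of the groups of order two and three that underlies
\<open>PSL(2,\<int>)\<close>. A hyperbolic \<open>h\<close> is conjugate, up to sign, to a word \<open>W\<close> that uses both letters. Up to
conjugation, inversion turns \<open>W\<close> into \<open>bar W\<close>, the reversed word with the letters exchanged, so if \<open>h\<close> is not conjugate to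
its inverse then \<open>bar W\<close> is no cyclic rotation of \<open>W\<close> and never occurs in a power of \<open>W\<close>. The
number of occurrences of \<open>W\<close> minus that of \<open>bar W\<close> is therefore at least \<open>t\<close> on \<open>W^t\<close>
(\<open>count_power\<close>), and it is a quasimorphism because multiplying two normal forms only cancels an inner
piece against its \<open>bar\<close> (\<open>spells_word_S_word\<close>). On bounded trace it is bounded: cyclic reduction
leaves finitely many words with both letters, and words with one letter contain neither \<open>W\<close> nor
\<open>bar W\<close> (\<open>brooks_bounded_trace\<close>).

Mixing is read off from characters. The correlation of two characters with frequencies \<open>v\<close> and \<open>w\<close>
vanishes unless the transpose of \<open>f\<^sup>(\<^sup>n\<^sup>)\<close> carries \<open>v\<close> to \<open>- w\<close>. Matrices that carry a nonzero \<open>v\<close> to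
a given vector differ by elements fixing \<open>v\<close>; these have trace 2, so \<open>q\<close> is bounded on all of them and
the drift excludes all but finitely many \<open>n\<close>. Passing from characters to square integrable functions
uses that bounded measurable functions arise from characters by linear combinations and bounded
pointwise limits (\<open>spectral_bounded_measurable\<close>) and that correlations are controlled by
\<open>L\<^sup>2\<close>-norms uniformly in \<open>n\<close> (\<open>time_correlation_bound\<close>).

Conversely, let \<open>g h g\<^sup>-\<^sup>1 = h\<^sup>-\<^sup>1\<close>. The kicks \<open>g\<^sup>-\<^sup>1, g, g\<^sup>-\<^sup>1, g, \<dots>\<close> undo the dynamics: for every \<open>t\<close>,
each second iterate is the identity, and a nontrivial character keeps its correlation with its own
conjugate.\<close>

section \<open>Integer matrices of size two and conjugacy\<close>

definition mat2 :: "int \<Rightarrow> int \<Rightarrow> int \<Rightarrow> int \<Rightarrow> int^2^2" where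
  "mat2 a b c d = (\<chi> i j. if i = 1 then (if j = 1 then a else b) else (if j = 1 then c else d))"

lemma mat2_entries [simp]:
  "mat2 a b c d $ 1 $ 1 = a" "mat2 a b c d $ 1 $ 2 = b" "mat2 a b c d $ 2 $ 1 = c" "mat2 a b c d $ 2 $ 2 = d"
  by (simp_all add: mat2_def)

lemma mat_eq_iff:
  "A = B \<longleftrightarrow> A $ 1 $ 1 = B $ 1 $ 1 \<and> A $ 1 $ 2 = B $ 1 $ 2 \<and> A $ 2 $ 1 = B $ 2 $ 1 \<and> A $ 2 $ 2 = B $ 2 $ 2"
  for A B :: "int^2^2"
  by (auto simp: vec_eq_iff forall_2)

lemma mult_entry: "(A ** B) $ i $ j = A $ i $ 1 * B $ 1 $ j + A $ i $ 2 * B $ 2 $ j"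
  for A B :: "int^2^2"
  by (simp add: matrix_matrix_mult_def sum_2)

lemma one_entries [simp]:
  "(mat 1 :: int^2^2) $ 1 $ 1 = 1" "(mat 1 :: int^2^2) $ 1 $ 2 = 0"
  "(mat 1 :: int^2^2) $ 2 $ 1 = 0" "(mat 1 :: int^2^2) $ 2 $ 2 = 1"
  by (simp_all add: mat_def)

lemma trace_2: "trace A = A $ 1 $ 1 + A $ 2 $ 2" for A :: "int^2^2"
  by (simp add: trace_def sum_2)

lemma transpose_entry [simp]: "transpose A $ i $ j = A $ j $ i"
  by (simp add: transpose_def)

lemma SL2Z_iff: "A \<in> SL2Z \<longleftrightarrow> A $ 1 $ 1 * A $ 2 $ 2 - A $ 1 $ 2 * A $ 2 $ 1 = 1"
  by (simp add: SL2Z_def det_2)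

lemma SL2Z_one [simp]: "mat 1 \<in> SL2Z"
  by (simp add: SL2Z_iff)

lemma SL2Z_mult [intro]: "A \<in> SL2Z \<Longrightarrow> B \<in> SL2Z \<Longrightarrow> A ** B \<in> SL2Z"
  by (simp add: SL2Z_def det_mul)

lemma SL2Z_mat_pow [intro]: "A \<in> SL2Z \<Longrightarrow> mat_pow A n \<in> SL2Z"
  by (induction n) auto

lemma matrix_inv_SL2Z:
  assumes "A \<in> SL2Z"
  shows "matrix_inv A = mat2 (A $ 2 $ 2) (- A $ 1 $ 2) (- A $ 2 $ 1) (A $ 1 $ 1)" (is "_ = ?B")
proof -
  have B: "A ** ?B = mat 1" "?B ** A = mat 1"
    using assms by (simp_all add: mat_eq_iff mult_entry SL2Z_iff algebra_simps)
  then have "A ** matrix_inv A = mat 1 \<and> matrix_inv A ** A = mat 1"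
    unfolding matrix_inv_def
    by (intro someI[where P = "\<lambda>C. A ** C = mat 1 \<and> C ** A = mat 1" and x = ?B] conjI)
  then show ?thesis
    by (metis (no_types) B(2) matrix_mul_assoc matrix_mul_lid matrix_mul_rid)
qed

lemma SL2Z_inv [simp]:
  assumes "A \<in> SL2Z"
  shows "matrix_inv A \<in> SL2Z" "A ** matrix_inv A = mat 1" "matrix_inv A ** A = mat 1"
    "matrix_inv (matrix_inv A) = A"
proof -
  show "matrix_inv A \<in> SL2Z"
    using assms by (simp add: matrix_inv_SL2Z SL2Z_iff algebra_simps)
  then show "A ** matrix_inv A = mat 1" "matrix_inv A ** A = mat 1" "matrix_inv (matrix_inv A) = A"
    using assms by (simp_all add: matrix_inv_SL2Z mat_eq_iff mult_entry SL2Z_iff algebra_simps)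
qed

lemma SL2Z_cancel [simp]:
  assumes "A \<in> SL2Z"
  shows "A ** (matrix_inv A ** B) = B" "matrix_inv A ** (A ** B) = B"
  using assms by (simp_all add: matrix_mul_assoc)

lemma matrix_inv_mult:
  assumes "A \<in> SL2Z" "B \<in> SL2Z"
  shows "matrix_inv (A ** B) = matrix_inv B ** matrix_inv A"
  using assms SL2Z_mult[OF assms] by (simp add: matrix_inv_SL2Z mat_eq_iff mult_entry)

lemma conjugate_refl: "conjugate_SL2Z A A"
proof -
  have "mat 1 ** A ** matrix_inv (mat 1) = A"
    using SL2Z_inv(2)[of "mat 1"] by simp
  then show ?thesis
    unfolding conjugate_SL2Z_def using SL2Z_one by blast
qed

lemma conjugate_sym: 
  assumes "conjugate_SL2Z A B" shows "conjugate_SL2Z B A"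
proof -
  from assms obtain g where g: "g \<in> SL2Z" "g ** A ** matrix_inv g = B"
    unfolding conjugate_SL2Z_def by blast
  then have "matrix_inv g ** B ** matrix_inv (matrix_inv g) = A"
    by (auto simp flip: matrix_mul_assoc)
  then show ?thesis
    unfolding conjugate_SL2Z_def using g SL2Z_inv(1) by blast
qed

lemma conjugate_trans [trans]:
  assumes "conjugate_SL2Z A B" "conjugate_SL2Z B C" shows "conjugate_SL2Z A C"
proof -
  from assms obtain g k where g: "g \<in> SL2Z" "g ** A ** matrix_inv g = B"
    and k: "k \<in> SL2Z" "k ** B ** matrix_inv k = C"
    unfolding conjugate_SL2Z_def by blast
  then have "(k ** g) ** A ** matrix_inv (k ** g) = C"
    by (auto simp: matrix_inv_mult matrix_mul_assoc)
  then show ?thesis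
    unfolding conjugate_SL2Z_def using g k by blast
qed

lemma conjugate_trace:
  assumes "conjugate_SL2Z A B"
  shows "trace A = trace B"
proof -
  from assms obtain g where g: "g \<in> SL2Z" "g ** A ** matrix_inv g = B"
    unfolding conjugate_SL2Z_def by blast
  have "trace B = trace (matrix_inv g ** (g ** A))"
    unfolding g(2)[symmetric] by (rule trace_mul_sym)
  then show ?thesis using g by simp
qed

lemma conjugate_mult_commute:
  assumes "A \<in> SL2Z"
  shows "conjugate_SL2Z (A ** B) (B ** A)"
proof -
  have "matrix_inv A ** (A ** B) ** matrix_inv (matrix_inv A) = B ** A"
    using assms by (simp add: matrix_mul_assoc)
  then show ?thesis
    unfolding conjugate_SL2Z_def using assms SL2Z_inv(1) by blast
qed

lemma neg_mult [simp]: "(- A) ** B = - (A ** B)" "A ** (- B) = - (A ** B)" for A B :: "int^2^2"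
  by (simp_all add: mat_eq_iff mult_entry)

lemma SL2Z_uminus [simp]: "- A \<in> SL2Z \<longleftrightarrow> A \<in> SL2Z"
  by (simp add: SL2Z_iff)

lemma conjugate_uminus: "conjugate_SL2Z A B \<Longrightarrow> conjugate_SL2Z (- A) (- B)"
  unfolding conjugate_SL2Z_def by auto

lemma conjugate_inv:
  assumes "conjugate_SL2Z A B" "A \<in> SL2Z"
  shows "conjugate_SL2Z (matrix_inv A) (matrix_inv B)"
proof -
  from assms obtain g where g: "g \<in> SL2Z" "g ** A ** matrix_inv g = B"
    unfolding conjugate_SL2Z_def by blast
  have "matrix_inv B = g ** matrix_inv A ** matrix_inv g"
    using g assms(2) by (auto simp: matrix_inv_mult SL2Z_mult simp flip: matrix_mul_assoc)
  then show ?thesis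
    unfolding conjugate_SL2Z_def using g(1) by auto
qed

definition S :: "int^2^2" where "S = mat2 0 (-1) 1 0"

definition S_group :: "(int^2^2) set" where "S_group = {mat 1, - mat 1, S, - S}"

lemma S_in_SL2Z [simp]: "S \<in> SL2Z"
  by (simp add: S_def SL2Z_iff)

lemma S_mult_S [simp]: "S ** S = - mat 1"
  by (simp add: S_def mat_eq_iff mult_entry)

lemma S_group_mult: "s \<in> S_group \<Longrightarrow> t \<in> S_group \<Longrightarrow> s ** t \<in> S_group"
  by (auto simp: S_group_def)

lemma S_group_inv: "s \<in> S_group \<Longrightarrow> \<exists>t\<in>S_group. t ** s = mat 1 \<and> s ** t = mat 1"
  by (auto simp: S_group_def)

lemma S_group_subset: "s \<in> S_group \<Longrightarrow> s \<in> SL2Z"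
  by (auto simp: S_group_def)

text \<open>Conjugation by \<open>S\<close> is inverse transpose on \<open>SL(2,\<int>)\<close>. This is what lets a word, read as a matrix,
cancel against its reversed and exchanged copy across a factor \<open>S\<close>.\<close>
lemma conj_S: 
  assumes "A \<in> SL2Z"
  shows "S ** transpose A = matrix_inv A ** S" "A ** S ** transpose A = S"
  using assms by (simp_all add: S_def mat_eq_iff mult_entry matrix_inv_SL2Z SL2Z_iff algebra_simps)

section \<open>Positive words\<close>

definition letter :: "bool \<Rightarrow> int^2^2" where
  "letter x = (if x then mat2 1 1 0 1 else mat2 1 0 1 1)"

fun word :: "bool list \<Rightarrow> int^2^2" where
  "word [] = mat 1"
| "word (x # w) = letter x ** word w"

text \<open>The word of the transposed matrix: transposition reverses products and exchanges the two letters.\<close>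
definition bar :: "bool list \<Rightarrow> bool list" where
  "bar w = rev (map Not w)"

lemma bar_simps [simp]: "bar [] = []" "bar (u @ v) = bar v @ bar u" "bar [x] = [\<not> x]" 
    "bar (bar w) = w" "length (bar w) = length w" "bar (x # w) = bar w @ [\<not> x]"
    "bar w = [] \<longleftrightarrow> w = []"
  by (auto simp: bar_def rev_map comp_def)

lemma set_bar: "x \<in> set (bar w) \<longleftrightarrow> (\<not> x) \<in> set w"
  by (cases x) (auto simp: bar_def image_iff)

lemma letter_SL2Z [simp]: "letter x \<in> SL2Z"
  by (simp add: letter_def SL2Z_iff)

lemma word_SL2Z [simp]: "word w \<in> SL2Z"
  by (induction w) auto

lemma word_append [simp]: "word (u @ v) = word u ** word v"
  by (induction u) (simp_all add: matrix_mul_assoc)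

lemma transpose_letter [simp]: "transpose (letter x) = letter (\<not> x)"
  by (simp add: letter_def mat_eq_iff)

lemma word_bar: "word (bar w) = transpose (word w)"
  by (induction w) (simp_all add: matrix_transpose_mul)

text \<open>The only other cancellation across \<open>S\<close>. In the free product of the groups of order two and three
the letters are \<open>u S\<close> and \<open>u\<^sup>-\<^sup>1 S\<close> with \<open>u\<close> of order three, and this is \<open>u u = u\<^sup>-\<^sup>1\<close>, all up to sign.\<close>
lemma letter_S_letter: "letter x ** S ** letter x = (if x then letter False else - letter True)"
  by (simp add: letter_def S_def mat_eq_iff mult_entry)

lemma word_entries:
  "word w $ 1 $ 1 \<ge> 1" "word w $ 2 $ 2 \<ge> 1" "word w $ 1 $ 2 \<ge> 0" "word w $ 2 $ 1 \<ge> 0"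
  by (induction w) (auto simp: letter_def mult_entry)

lemma word_entry_12: "word w $ 1 $ 2 > 0 \<longleftrightarrow> True \<in> set w"
proof (induction w)
  case (Cons x w)
  then show ?case using word_entries[of w] by (cases x) (auto simp: letter_def mult_entry)
qed simp

lemma word_entry_21: "word w $ 2 $ 1 > 0 \<longleftrightarrow> False \<in> set w"
  using word_entry_12[of "bar w"] by (simp add: word_bar set_bar)

text \<open>Words generate a free monoid: multiplying by a letter on the left makes one row dominate the other,
so the first letter can be read off from the matrix.\<close>
lemma word_inj: "word u = word v \<Longrightarrow> u = v"
proof (induction u arbitrary: v)
  case Nil
  then show ?case
    using word_entry_12[of v] word_entry_21[of v] by (cases v) (metis (full_types) list.set_intros(1) one_entries(2,3) word.simps(1) order_less_irrefl)+
next
  case (Cons x u)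
  show ?case
  proof (cases v)
    case Nil
    then show ?thesis
      using Cons.prems word_entry_12[of "x # u"] word_entry_21[of "x # u"]
      by (cases x) auto
  next
    case (Cons y v')
    have xy: "x = y"
      using Cons.prems word_entries[of u] word_entries[of v'] unfolding Cons
      by (cases x; cases y) (auto simp: letter_def mat_eq_iff mult_entry)
    have "matrix_inv (letter x) ** (letter x ** word u) = matrix_inv (letter x) ** (letter x ** word v')"
      using Cons.prems unfolding Cons by (simp add: xy)
    then have "word u = word v'"
      by simp
    then show ?thesis using Cons.IH Cons xy by simp
  qed
qed

section \<open>Counting subwords\<close>

definition positions :: "'a list \<Rightarrow> 'a list \<Rightarrow> nat set" where
  "positions W v = {i. \<exists>p s. v = p @ W @ s \<and> length p = i}"

definition occ :: "'a list \<Rightarrow> 'a list \<Rightarrow> nat" where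
  "occ W v = card (positions W v)"

lemma positions_subset: "positions W v \<subseteq> {..length v}"
  by (auto simp: positions_def)

lemma finite_positions [simp]: "finite (positions W v)"
  using positions_subset finite_subset by blast

text \<open>Besides the occurrences inside one of the two factors there are those that overlap the cut; they
start less than the length of \<open>W\<close> before it. This is why subword counts are additive up to a bounded error.\<close>
lemma positions_append:
  "positions W (u @ v) \<subseteq> positions W u \<union> (\<lambda>i. length u + i) ` positions W v \<union> {length u - length W..<length u}"
proof
  fix i assume "i \<in> positions W (u @ v)"
  then obtain p s where ps: "u @ v = p @ W @ s" "length p = i"
    by (auto simp: positions_def)
  consider "i + length W \<le> length u" | "length u \<le> i" | "i < length u" "length u < i + length W"
    by linarith
  then show "i \<in> positions W u \<union> (\<lambda>i. length u + i) ` positions W v \<union> {length u - length W..<length u}"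
  proof cases
    case 1
    have "u = take (length u) (p @ W @ s)"
      by (metis append_eq_conv_conj ps(1))
    also have "\<dots> = p @ W @ take (length u - i - length W) s"
      using 1 ps(2) by simp
    finally show ?thesis
      using ps(2) unfolding positions_def by blast
  next
    case 2
    have "v = drop (length u) (p @ W @ s)"
      by (metis append_eq_conv_conj ps(1))
    moreover have "p = take (length u) (p @ W @ s) @ drop (length u) p"
      using 2 ps(2) by simp
    ultimately have "v = drop (length u) p @ W @ s"
      using 2 ps(2) by simp
    then have "i - length u \<in> positions W v"
      using ps(2) unfolding positions_def by auto
    then show ?thesis
      using 2 by (auto simp: image_iff intro!: bexI[of _ "i - length u"])
  next
    case 3
    then show ?thesis by auto
  qed
qed

lemma occ_append_le: "occ W (u @ v) \<le> occ W u + occ W v + length W"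
proof -
  have "occ W (u @ v) \<le> card (positions W u \<union> (\<lambda>i. length u + i) ` positions W v \<union> {length u - length W..<length u})"
    unfolding occ_def by (rule card_mono[OF _ positions_append]) auto
  also have "\<dots> \<le> card (positions W u) + card ((\<lambda>i. length u + i) ` positions W v) + card {length u - length W..<length u}"
    by (meson card_Un_le add_le_mono1 order_trans)
  also have "\<dots> \<le> occ W u + occ W v + length W"
    unfolding occ_def by (intro add_mono card_image_le) auto
  finally show ?thesis .
qed

lemma occ_append_ge:
  assumes "W \<noteq> []"
  shows "occ W u + occ W v \<le> occ W (u @ v)"
proof -
  have "occ W u + occ W v = card (positions W u \<union> (\<lambda>i. length u + i) ` positions W v)"
    unfolding occ_def using assms
    by (subst card_Un_disjoint) (simp_all add: card_image, auto simp: positions_def)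
  also have "\<dots> \<le> occ W (u @ v)"
  proof -
    have "i \<in> positions W (u @ v)" if "i \<in> positions W u" for i
      using that by (fastforce simp: positions_def)
    moreover have "length u + i \<in> positions W (u @ v)" if "i \<in> positions W v" for i
    proof -
      from that obtain p s where "v = p @ W @ s" "length p = i"
        by (auto simp: positions_def)
      then have "u @ v = (u @ p) @ W @ s \<and> length (u @ p) = length u + i"
        by simp
      then show ?thesis unfolding positions_def by blast
    qed
    ultimately show ?thesis
      unfolding occ_def by (intro card_mono) auto
  qed
  finally show ?thesis .
qed

lemma occ_pos_imp: "occ W v > 0 \<Longrightarrow> \<exists>p s. v = p @ W @ s"
  unfolding occ_def by (auto simp: card_gt_0_iff positions_def)

lemma occ_self: "occ W W = 1"
proof -
  have "p = [] \<and> s = []" if "W = p @ W @ s" for p s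
    using arg_cong[OF that, of length] by simp
  then have "positions W W = {0}" by (auto simp: positions_def)
  then show ?thesis by (simp add: occ_def)
qed

lemma occ_bar_le: "occ W v \<le> occ (bar W) (bar v)"
  unfolding occ_def
proof (rule card_inj_on_le[where f = "\<lambda>i. length v - length W - i"])
  show "inj_on (\<lambda>i. length v - length W - i) (positions W v)"
  proof (rule inj_onI)
    have "i + length W \<le> length v" if "i \<in> positions W v" for i
      using that by (auto simp: positions_def)
    then show "i = j" if "i \<in> positions W v" "j \<in> positions W v"
        "length v - length W - i = length v - length W - j" for i j
      using that by (metis add_le_imp_le_diff diff_diff_cancel)
  qed
  show "(\<lambda>i. length v - length W - i) ` positions W v \<subseteq> positions (bar W) (bar v)"
  proof (clarsimp simp: positions_def)
    fix p s
    show "\<exists>p'. (\<exists>s'. bar s @ bar W @ bar p = p' @ bar W @ s') \<and> length p' = length s"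
      by (intro exI[of _ "bar s"]) auto
  qed
qed simp

lemma occ_bar: "occ (bar W) (bar v) = occ W v"
  using occ_bar_le[of W v] occ_bar_le[of "bar W" "bar v"] by simp

text \<open>The occurrences of \<open>bar W\<close> enter negatively so that a cancelled piece and its \<open>bar\<close> contribute
opposite amounts.\<close>
definition count :: "bool list \<Rightarrow> bool list \<Rightarrow> int" where
  "count W v = int (occ W v) - int (occ (bar W) v)"

lemma count_bar: "count W (bar v) = - count W v"
  using occ_bar[of W v] occ_bar[of "bar W" v] by (simp add: count_def)

lemma count_append:
  assumes "W \<noteq> []"
  shows "\<bar>count W (u @ v) - count W u - count W v\<bar> \<le> int (length W)"
  using occ_append_le[of W u v] occ_append_le[of "bar W" u v]
    occ_append_ge[of W u v] occ_append_ge[of "bar W" u v] assms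
  unfolding count_def by auto

text \<open>Words in at most one letter spell the unipotent matrices. A counted word that is mixed is absent from them.\<close>
definition mixed :: "bool list \<Rightarrow> bool" where
  "mixed w \<longleftrightarrow> True \<in> set w \<and> False \<in> set w"

lemma mixed_bar [simp]: "mixed (bar w) = mixed w"
  by (auto simp: mixed_def set_bar)

lemma count_not_mixed:
  assumes "mixed W" "\<not> mixed v"
  shows "count W v = 0"
proof -
  have "occ V v = 0" if "mixed V" for V
  proof (rule ccontr)
    assume "occ V v \<noteq> 0"
    then obtain p s where "v = p @ V @ s"
      using occ_pos_imp by blast
    then have "set V \<subseteq> set v" by auto
    then show False
      using that assms(2) by (auto simp: mixed_def)
  qed
  then show ?thesis using assms(1) by (simp add: count_def)
qed

lemma not_mixed_simps [simp]: "\<not> mixed []" "\<not> mixed [x]"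
  by (auto simp: mixed_def)

section \<open>Normal forms\<close>

definition spells :: "int^2^2 \<Rightarrow> bool list \<Rightarrow> bool" where
  "spells A w \<longleftrightarrow> (\<exists>s\<in>S_group. \<exists>t\<in>S_group. A = s ** word w ** t)"

lemma spells_S_group_mult:
  assumes "spells A w" "s \<in> S_group" "t \<in> S_group"
  shows "spells (s ** A ** t) w"
proof -
  from assms(1) obtain s' t' where "s' \<in> S_group" "t' \<in> S_group" "A = s' ** word w ** t'"
    unfolding spells_def by blast
  then have "s ** A ** t = (s ** s') ** word w ** (t' ** t)"
    by (simp add: matrix_mul_assoc)
  then show ?thesis
    unfolding spells_def using S_group_mult \<open>s' \<in> S_group\<close> \<open>t' \<in> S_group\<close> assms by blast
qed

lemma S_group_members [simp]: "mat 1 \<in> S_group" "S \<in> S_group" "- mat 1 \<in> S_group" "- S \<in> S_group"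
  by (simp_all add: S_group_def)

lemma spells_word [simp]: "spells (word w) w"
  unfolding spells_def by (intro bexI[of _ "mat 1"]) simp_all

lemma spells_uminus: "spells A w \<Longrightarrow> spells (- A) w"
  using spells_S_group_mult[of A w "- mat 1" "mat 1"] by simp

lemma spells_S: "spells A w \<Longrightarrow> spells (S ** A) w"
  using spells_S_group_mult[of A w S "mat 1"] by simp

text \<open>A word has entries \<open>\<ge> 1\<close> on the diagonal and \<open>\<ge> 0\<close> off it; a factor \<open>S\<close> on one side or a
sign destroys this pattern. A factor \<open>S\<close> on both sides gives the inverse transpose up to sign, and then
both words are empty.\<close>
lemma word_S_group_unique:
  assumes "s \<in> S_group" "t \<in> S_group" "word v = s ** word w ** t"
  shows "v = w"
proof -
  consider "word v = word w" | "word v = - word w" | "word v = S ** word w" | "word v = - (S ** word w)"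
    | "word v = word w ** S" | "word v = - (word w ** S)"
    | "word v = S ** word w ** S" | "word v = - (S ** word w ** S)"
    using assms by (auto simp: S_group_def)
  then show ?thesis
  proof cases
    case 8
    then have "word v = mat 1 \<and> word w = mat 1"
      using word_entries[of v] word_entries[of w] 
        word_SL2Z[of v, unfolded SL2Z_iff] word_SL2Z[of w, unfolded SL2Z_iff]
      by (auto simp: S_def mat_eq_iff mult_entry zmult_eq_1_iff)
    then show ?thesis by (intro word_inj) simp
  qed (use word_inj word_entries[of v] word_entries[of w] in \<open>auto simp: S_def mat_eq_iff mult_entry\<close>)
qed

lemma spells_unique:
  assumes "spells A v" "spells A w"
  shows "v = w"
proof -
  from assms obtain s t s' t' where *: "s \<in> S_group" "t \<in> S_group" "A = s ** word v ** t"
    "s' \<in> S_group" "t' \<in> S_group" "A = s' ** word w ** t'"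
    unfolding spells_def by blast
  obtain si ti where i: "si \<in> S_group" "si ** s = mat 1" "ti \<in> S_group" "t ** ti = mat 1"
    using S_group_inv * by metis
  have "word v = si ** (s ** word v ** t) ** ti"
    using i by (simp add: matrix_mul_assoc) (simp add: i flip: matrix_mul_assoc)
  also have "\<dots> = (si ** s') ** word w ** (t' ** ti)"
    unfolding *(3)[symmetric] unfolding *(6) by (simp add: matrix_mul_assoc)
  finally show ?thesis
    using word_S_group_unique[of "si ** s'" "t' ** ti" v w] S_group_mult i * by blast
qed

text \<open>The maximal piece \<open>q\<close> that cancels in \<open>word w ** S ** word w'\<close>. Where cancellation stops with letters
left on both sides, these two letters agree.\<close>
lemma cancellation:
  "\<exists>p q p'. w = p @ q \<and> w' = bar q @ p' \<and> (p = [] \<or> p' = [] \<or> (\<exists>x p1 p1'. p = p1 @ [x] \<and> p' = x # p1'))"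
proof (induction w arbitrary: w' rule: rev_induct)
  case Nil
  then show ?case by auto
next
  case (snoc x w)
  show ?case
  proof (cases w')
    case Nil
    then show ?thesis by (intro exI[of _ "w @ [x]"] exI[of _ "[]"]) auto
  next
    case (Cons y v)
    show ?thesis
    proof (cases "y = x")
      case True
      show ?thesis
        unfolding Cons True by (rule exI[where x = "w @ [x]"], rule exI[where x = "[]"], rule exI[where x = "x # v"]) auto
    next
      case False
      then have y: "y = (\<not> x)" by simp
      obtain p q p' where "w = p @ q" "v = bar q @ p'"
        "p = [] \<or> p' = [] \<or> (\<exists>x p1 p1'. p = p1 @ [x] \<and> p' = x # p1')"
        using snoc.IH by blast
      then show ?thesis
        unfolding Cons y by - (rule exI[where x = p], rule exI[where x = "q @ [x]"], rule exI[where x = p'], auto)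
    qed
  qed
qed

lemma word_S_word_bar: "word q ** S ** word (bar q) = S"
  by (simp add: word_bar conj_S)

text \<open>The cancelled piece \<open>q\<close> contributes \<open>count W q\<close> to \<open>w\<close> and \<open>- count W q\<close> to \<open>w'\<close>, so it drops out of
the sum; at the place where cancellation stops two letters merge into one. The constant 6 collects the
six concatenations that are used.\<close>
lemma spells_word_S_word:
  assumes W: "mixed W"
  shows "\<exists>v. spells (word w ** S ** word w') v \<and> \<bar>count W v - count W w - count W w'\<bar> \<le> 6 * int (length W)"
proof -
  have ne: "W \<noteq> []" using W by auto
  note app = count_append[OF ne]
  obtain p q p' where pq: "w = p @ q" "w' = bar q @ p'"
    "p = [] \<or> p' = [] \<or> (\<exists>x p1 p1'. p = p1 @ [x] \<and> p' = x # p1')"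
    using cancellation by blast
  have red: "word w ** S ** word w' = word p ** S ** word p'"
  proof -
    have "word w ** S ** word w' = word p ** (word q ** S ** word (bar q)) ** word p'"
      unfolding pq(1,2) by (simp add: matrix_mul_assoc)
    then show ?thesis by (simp add: word_S_word_bar)
  qed
  have w: "\<bar>count W w - count W p - count W q\<bar> \<le> int (length W)"
    using app[of p q] pq by simp
  have w': "\<bar>count W w' + count W q - count W p'\<bar> \<le> int (length W)"
    using app[of "bar q" p'] pq by (simp add: count_bar)
  from pq(3) consider "p = []" | "p' = []" | x p1 p1' where "p = p1 @ [x]" "p' = x # p1'"
    by blast
  then show ?thesis
  proof cases
    case 1
    then have "spells (word w ** S ** word w') p'"
      using red by (simp add: spells_S)
    moreover have "count W p = 0" using 1 count_not_mixed[OF W] by simp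
    ultimately show ?thesis
      using w w' by (intro exI[of _ p']) auto
  next
    case 2
    then have "spells (word w ** S ** word w') p"
      using red spells_S_group_mult[of "word p" p "mat 1" S] by simp
    moreover have "count W p' = 0" using 2 count_not_mixed[OF W] by simp
    ultimately show ?thesis
      using w w' by (intro exI[of _ p]) auto
  next
    case 3
    let ?v = "p1 @ [\<not> x] @ p1'"
    have "word w ** S ** word w' = word p1 ** (letter x ** S ** letter x) ** word p1'"
      using red 3 by (simp add: matrix_mul_assoc)
    also have "\<dots> = word ?v \<or> \<dots> = - word ?v"
      by (cases x) (simp_all add: letter_S_letter matrix_mul_assoc)
    finally have sp: "spells (word w ** S ** word w') ?v"
      using spells_word spells_uminus by metis
    have 0: "count W [y] = 0" for y using count_not_mixed[OF W] by simp
    have "\<bar>count W ?v - count W p1 - count W p1'\<bar> \<le> 2 * int (length W)"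
      using app[of p1 "[\<not> x] @ p1'"] app[of "[\<not> x]" p1'] 0[of "\<not> x"] by linarith
    moreover have "\<bar>count W p - count W p1\<bar> \<le> int (length W)"
      using app[of p1 "[x]"] 0[of x] 3 by simp
    moreover have "\<bar>count W p' - count W p1'\<bar> \<le> int (length W)"
      using app[of "[x]" p1'] 0[of x] 3 by simp
    ultimately have "\<bar>count W ?v - count W w - count W w'\<bar> \<le> 6 * int (length W)"
      using w w' by linarith
    with sp show ?thesis by blast
  qed
qed

lemma spells_mult:
  assumes W: "mixed W" and A: "spells A w" and B: "spells B w'"
  shows "\<exists>v. spells (A ** B) v \<and> \<bar>count W v - count W w - count W w'\<bar> \<le> 6 * int (length W)"
proof -
  have ne: "W \<noteq> []" using W by auto
  obtain s t where s: "s \<in> S_group" "t \<in> S_group" "A = s ** word w ** t"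
    using A unfolding spells_def by blast
  obtain s' t' where s': "s' \<in> S_group" "t' \<in> S_group" "B = s' ** word w' ** t'"
    using B unfolding spells_def by blast
  have eq: "A ** B = s ** (word w ** (t ** s') ** word w') ** t'"
    using s s' by (simp add: matrix_mul_assoc)
  have S_group: "t ** s' \<in> S_group" using S_group_mult s s' by blast
  have "\<exists>v. spells (word w ** (t ** s') ** word w') v \<and> \<bar>count W v - count W w - count W w'\<bar> \<le> 6 * int (length W)"
  proof -
    have 1: "spells (word w ** word w') (w @ w')"
      using spells_word[of "w @ w'"] by simp
    have 2: "\<bar>count W (w @ w') - count W w - count W w'\<bar> \<le> 6 * int (length W)"
      using count_append[OF ne, of w w'] by linarith
    note 3 = spells_word_S_word[OF W, of w w']
    from S_group consider "t ** s' = mat 1" | "t ** s' = - mat 1" | "t ** s' = S" | "t ** s' = - S"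
      by (auto simp: S_group_def)
    then show ?thesis
      by cases (use 1 2 3 spells_uminus in \<open>auto\<close>)
  qed
  then show ?thesis
    unfolding eq using spells_S_group_mult s(1) s'(2) by blast
qed

text \<open>The inverse of a letter is spelled by the other letter, because conjugation by \<open>S\<close> is inverse
transpose. The normal form of a product then comes from \<open>spells_mult\<close>.\<close>
lemma spells_letter_mult:
  assumes "spells A w"
  shows "\<exists>v. spells (letter x ** A) v" "\<exists>v. spells (matrix_inv (letter x) ** A) v"
proof -
  have W: "mixed [True, False]" by (simp add: mixed_def)
  have "spells (letter x) [x]"
    using spells_word[of "[x]"] by simp
  then show "\<exists>v. spells (letter x ** A) v"
    using spells_mult[OF W _ assms] by blast
  have "matrix_inv (letter x) = - ((matrix_inv (letter x) ** S) ** S)"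
    by (simp flip: matrix_mul_assoc)
  also have "\<dots> = S ** word [\<not> x] ** (- S)"
    by (simp flip: conj_S(1))
  finally have "spells (matrix_inv (letter x)) [\<not> x]"
    unfolding spells_def by (metis S_group_members(2,4))
  then show "\<exists>v. spells (matrix_inv (letter x) ** A) v"
    using spells_mult[OF W _ assms] by blast
qed

lemma matrix_inv_letter: "matrix_inv (letter x) = (if x then mat2 1 (- 1) 0 1 else mat2 1 0 (- 1) 1)"
  by (subst matrix_inv_SL2Z[OF letter_SL2Z]) (simp add: letter_def)

lemma spells_upper_unipotent: "\<exists>w. spells (mat2 1 b 0 1) w"
proof (induction b rule: int_induct[where k = 0])
  case base
  have "mat2 1 0 0 1 = word []" by (simp add: mat_eq_iff)
  then show ?case using spells_word by metis
next
  case (step1 b)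
  have "mat2 1 (b + 1) 0 1 = letter True ** mat2 1 b 0 1"
    by (simp add: mat_eq_iff mult_entry letter_def)
  then show ?case using step1.IH spells_letter_mult(1) by metis
next
  case (step2 b)
  have "mat2 1 (b - 1) 0 1 = matrix_inv (letter True) ** mat2 1 b 0 1"
    by (simp add: matrix_inv_letter mat_eq_iff mult_entry)
  then show ?case using step2.IH spells_letter_mult(2) by metis
qed

text \<open>Euclid's algorithm on the first column: a letter or its inverse on the left subtracts one entry
from the other. It ends in an upper triangular matrix or, up to sign, in \<open>S\<close> times one.\<close>
lemma spells_exists:
  assumes "A \<in> SL2Z"
  shows "\<exists>w. spells A w"
  using assms
proof (induction "nat (\<bar>A $ 1 $ 1\<bar> + \<bar>A $ 2 $ 1\<bar>)" arbitrary: A rule: less_induct)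
  case less
  have upper: "\<exists>w. spells B w" if "B \<in> SL2Z" "B $ 2 $ 1 = 0" for B
  proof -
    have "B $ 1 $ 1 * B $ 2 $ 2 = 1"
      using that by (simp add: SL2Z_iff)
    then have "B = mat2 1 (B $ 1 $ 2) 0 1 \<or> B = - mat2 1 (- (B $ 1 $ 2)) 0 1"
      using that(2) by (auto simp: mat_eq_iff zmult_eq_1_iff)
    then show ?thesis
      using spells_upper_unipotent spells_uminus by metis
  qed
  consider "A $ 2 $ 1 = 0" | "A $ 1 $ 1 = 0" | "A $ 1 $ 1 \<noteq> 0" "A $ 2 $ 1 \<noteq> 0"
    by blast
  then show ?case
  proof cases
    case 1
    then show ?thesis using upper less.prems by blast
  next
    case 2
    have "\<exists>w. spells (S ** A) w"
    proof (rule upper)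
      show "S ** A \<in> SL2Z" using less.prems by auto
      show "(S ** A) $ 2 $ 1 = 0" using 2 by (simp add: S_def mult_entry)
    qed
    moreover have "A = - (S ** (S ** A))"
      by (simp add: matrix_mul_assoc)
    ultimately show ?thesis
      using spells_S spells_uminus by metis
  next
    case 3
    have smaller: "\<exists>w. spells B w"
      if "B \<in> SL2Z" "\<bar>B $ 1 $ 1\<bar> + \<bar>B $ 2 $ 1\<bar> < \<bar>A $ 1 $ 1\<bar> + \<bar>A $ 2 $ 1\<bar>" for B
      using that by (intro less.hyps) (simp_all add: nat_less_eq_zless)
    \<comment> \<open>The larger entry is reduced: \<open>True\<close> acts on the first row, \<open>False\<close> on the second, and the sign decides between the letter and its inverse.\<close>
    have "\<exists>x. \<bar>(letter x ** A) $ 1 $ 1\<bar> + \<bar>(letter x ** A) $ 2 $ 1\<bar> < \<bar>A $ 1 $ 1\<bar> + \<bar>A $ 2 $ 1\<bar>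
        \<or> \<bar>(matrix_inv (letter x) ** A) $ 1 $ 1\<bar> + \<bar>(matrix_inv (letter x) ** A) $ 2 $ 1\<bar> < \<bar>A $ 1 $ 1\<bar> + \<bar>A $ 2 $ 1\<bar>"
    proof -
      have entries:
        "(letter True ** A) $ 1 $ 1 = A $ 1 $ 1 + A $ 2 $ 1" "(letter True ** A) $ 2 $ 1 = A $ 2 $ 1"
        "(matrix_inv (letter True) ** A) $ 1 $ 1 = A $ 1 $ 1 - A $ 2 $ 1"
        "(matrix_inv (letter True) ** A) $ 2 $ 1 = A $ 2 $ 1"
        "(letter False ** A) $ 1 $ 1 = A $ 1 $ 1" "(letter False ** A) $ 2 $ 1 = A $ 1 $ 1 + A $ 2 $ 1"
        "(matrix_inv (letter False) ** A) $ 1 $ 1 = A $ 1 $ 1"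
        "(matrix_inv (letter False) ** A) $ 2 $ 1 = A $ 2 $ 1 - A $ 1 $ 1"
        by (simp_all add: matrix_inv_letter mult_entry) (simp_all add: letter_def)
      show ?thesis
        unfolding ex_bool_eq entries using 3 by arith
    qed
    then obtain x where "\<bar>(letter x ** A) $ 1 $ 1\<bar> + \<bar>(letter x ** A) $ 2 $ 1\<bar> < \<bar>A $ 1 $ 1\<bar> + \<bar>A $ 2 $ 1\<bar>
        \<or> \<bar>(matrix_inv (letter x) ** A) $ 1 $ 1\<bar> + \<bar>(matrix_inv (letter x) ** A) $ 2 $ 1\<bar> < \<bar>A $ 1 $ 1\<bar> + \<bar>A $ 2 $ 1\<bar>"
      by blast
    then have "(\<exists>w. spells (letter x ** A) w) \<or> (\<exists>w. spells (matrix_inv (letter x) ** A) w)"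
      using smaller[of "letter x ** A"] smaller[of "matrix_inv (letter x) ** A"] less.prems
      by (auto simp: SL2Z_mult)
    then show ?thesis
      using spells_letter_mult[of _ _ x] SL2Z_cancel[OF letter_SL2Z[of x], of A] by metis
  qed
qed

section \<open>The counting quasimorphism\<close>

definition brooks :: "bool list \<Rightarrow> int^2^2 \<Rightarrow> int" where
  "brooks W A = count W (THE w. spells A w)"

lemma brooks_eq: "spells A w \<Longrightarrow> brooks W A = count W w"
  unfolding brooks_def by (rule arg_cong[where f = "count W"], rule the_equality) (auto intro: spells_unique)

lemma brooks_mult:
  assumes "mixed W" "A \<in> SL2Z" "B \<in> SL2Z"
  shows "\<bar>brooks W (A ** B) - brooks W A - brooks W B\<bar> \<le> 6 * int (length W)"
proof -
  obtain w w' where w: "spells A w" "spells B w'"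
    using spells_exists[OF assms(2)] spells_exists[OF assms(3)] by blast
  obtain v where "spells (A ** B) v" "\<bar>count W v - count W w - count W w'\<bar> \<le> 6 * int (length W)"
    using spells_mult[OF assms(1) w] by blast
  then show ?thesis using w by (simp add: brooks_eq)
qed

lemma brooks_uminus:
  assumes "A \<in> SL2Z"
  shows "brooks W (- A) = brooks W A"
proof -
  obtain w where w: "spells A w" using spells_exists[OF assms] by blast
  show ?thesis
    using brooks_eq[OF w] brooks_eq[OF spells_uminus[OF w]] by simp
qed

lemma brooks_one: "mixed W \<Longrightarrow> brooks W (mat 1) = 0"
  using brooks_eq[OF spells_word, of W "[]"] by (simp add: count_not_mixed)

text \<open>A quasimorphism vanishing at the identity is almost odd, hence changes by a bounded amount under
conjugation, uniformly in the conjugating element. Three products enter, each at the cost of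
\<open>6 * length W\<close>.\<close>
lemma brooks_conjugate:
  assumes W: "mixed W" and "A \<in> SL2Z" "conjugate_SL2Z A B"
  shows "\<bar>brooks W A - brooks W B\<bar> \<le> 18 * int (length W)"
proof -
  obtain g where g: "g \<in> SL2Z" "g ** A ** matrix_inv g = B"
    using assms unfolding conjugate_SL2Z_def by blast
  show ?thesis
    using brooks_mult[OF W, of "g ** A" "matrix_inv g"] brooks_mult[OF W, of g A]
      brooks_mult[OF W, of g "matrix_inv g"] assms g
    by (simp add: SL2Z_mult brooks_one)
qed

section \<open>Cyclic reduction and bounded trace\<close>

text \<open>The second alternative covers the elliptic classes: \<open>S\<close> and \<open>S\<close> times a letter have order 4, 3 or 6.\<close>
definition cyclically_reduced :: "int^2^2 \<Rightarrow> bool" where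
  "cyclically_reduced B \<longleftrightarrow>
     (\<exists>v. (B = word v \<or> B = - word v) \<or> length v \<le> 1 \<and> (B = S ** word v \<or> B = - (S ** word v)))"

lemma cyclically_reduced_uminus: "cyclically_reduced B \<Longrightarrow> cyclically_reduced (- B)"
  unfolding cyclically_reduced_def by (metis minus_minus)

lemma cyclically_reduced_word: "cyclically_reduced (word v)"
  unfolding cyclically_reduced_def by blast

text \<open>Moving the last letter to the front puts it next to \<open>S\<close> and the first letter. If the two letters
agree, all three merge into one letter, up to sign, and \<open>S\<close> disappears; otherwise they cancel and the word gets shorter.\<close>
lemma conjugate_S_word_reduced:
  "\<exists>B. conjugate_SL2Z (S ** word w) B \<and> cyclically_reduced B"
proof (induction w rule: length_induct)
  case (1 w)
  consider "length w \<le> 1" | x v y where "w = x # v @ [y]"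
    by (cases w; cases "tl w" rule: rev_cases) auto
  then show ?case
  proof cases
    case 1
    then show ?thesis using conjugate_refl unfolding cyclically_reduced_def by blast
  next
    case 2
    have "conjugate_SL2Z ((S ** letter x ** word v) ** letter y) (letter y ** (S ** letter x ** word v))"
      by (rule conjugate_mult_commute) (simp add: SL2Z_mult)
    then have conj: "conjugate_SL2Z (S ** word w) ((letter y ** S ** letter x) ** word v)"
      using 2 by (simp add: matrix_mul_assoc)
    show ?thesis
    proof (cases "y = x")
      case True
      have "(letter y ** S ** letter x) ** word v = word ((\<not> x) # v) \<or>
            (letter y ** S ** letter x) ** word v = - word ((\<not> x) # v)"
        using True by (simp add: letter_S_letter)
      with conj show ?thesis unfolding cyclically_reduced_def by blast
    next
      case False
      then have x: "letter x = transpose (letter y)" by simp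
      have "letter y ** S ** letter x = S"
        unfolding x by (rule conj_S(2)[OF letter_SL2Z])
      then have step: "conjugate_SL2Z (S ** word w) (S ** word v)"
        using conj by simp
      have "length v < length w" using 2 by simp
      then obtain B where "conjugate_SL2Z (S ** word v) B" "cyclically_reduced B"
        using 1 by blast
      then show ?thesis
        using conjugate_trans[OF step] by blast
    qed
  qed
qed

lemma conjugate_cyclically_reduced:
  assumes "A \<in> SL2Z"
  obtains B where "conjugate_SL2Z A B" "cyclically_reduced B"
proof -
  obtain w s t where w: "s \<in> S_group" "t \<in> S_group" "A = s ** word w ** t"
    using spells_exists[OF assms] unfolding spells_def by blast
  have conj: "conjugate_SL2Z A (t ** s ** word w)"
    using conjugate_mult_commute[of "s ** word w" t] w by (simp add: SL2Z_mult S_group_subset matrix_mul_assoc)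
  obtain B where B: "conjugate_SL2Z (S ** word w) B" "cyclically_reduced B"
    using conjugate_S_word_reduced by blast
  have "t ** s \<in> S_group" using S_group_mult w by blast
  then consider "t ** s = mat 1" | "t ** s = - mat 1" | "t ** s = S" | "t ** s = - S"
    by (auto simp: S_group_def)
  then show ?thesis
  proof cases
    case 1
    then show ?thesis using that[OF _ cyclically_reduced_word] conj by simp
  next
    case 2
    then show ?thesis using that[OF _ cyclically_reduced_uminus[OF cyclically_reduced_word]] conj by simp
  next
    case 3
    then show ?thesis using that[OF _ B(2)] conjugate_trans[OF conj] B(1) by simp
  next
    case 4
    then show ?thesis
      using that[OF _ cyclically_reduced_uminus[OF B(2)]] conjugate_trans[OF conj]
        conjugate_uminus[OF B(1)] by simp
  qed
qed

text \<open>For a mixed word all four entries are positive. The trace bounds the diagonal, and the determinant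
equation then bounds the product of the other two entries.\<close>
lemma finite_mixed_words_bounded_trace:
  "finite {w. mixed w \<and> trace (word w) \<le> T}"
proof (rule finite_imageD)
  let ?I = "{0..T + T\<^sup>2}"
  show "finite (word ` {w. mixed w \<and> trace (word w) \<le> T})"
  proof (rule finite_subset)
    show "finite ((\<lambda>(a, b, c, d). mat2 a b c d) ` (?I \<times> ?I \<times> ?I \<times> ?I))"
      by simp
    show "word ` {w. mixed w \<and> trace (word w) \<le> T} \<subseteq> (\<lambda>(a, b, c, d). mat2 a b c d) ` (?I \<times> ?I \<times> ?I \<times> ?I)"
    proof clarify
      fix w assume w: "mixed w" "trace (word w) \<le> T"
      let ?a = "word w $ 1 $ 1" and ?b = "word w $ 1 $ 2" and ?c = "word w $ 2 $ 1" and ?d = "word w $ 2 $ 2"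
      have pos: "?a \<ge> 1" "?b \<ge> 1" "?c \<ge> 1" "?d \<ge> 1"
        using word_entries[of w] word_entry_12[of w] word_entry_21[of w] w(1) by (auto simp: mixed_def)
      have T: "?a \<le> T" "?d \<le> T"
        using w(2) pos by (auto simp: trace_2)
      have bc: "?b * ?c \<le> T\<^sup>2"
      proof -
        have "?b * ?c \<le> ?a * ?d"
          using word_SL2Z[of w] by (simp add: SL2Z_iff)
        also have "\<dots> \<le> T * T"
          using T pos by (intro mult_mono) auto
        finally show ?thesis by (simp add: power2_eq_square)
      qed
      have "?b \<le> ?b * ?c" "?c \<le> ?b * ?c"
        using mult_left_mono[of 1 ?c ?b] mult_right_mono[of 1 ?b ?c] pos by simp_all
      then have "?b \<le> T\<^sup>2" "?c \<le> T\<^sup>2" using bc by linarith+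
      then have "(?a, ?b, ?c, ?d) \<in> ?I \<times> ?I \<times> ?I \<times> ?I"
        using T pos by auto
      then show "word w \<in> (\<lambda>(a, b, c, d). mat2 a b c d) ` (?I \<times> ?I \<times> ?I \<times> ?I)"
        by (rule rev_image_eqI) (simp add: mat_eq_iff)
    qed
  qed
  show "inj_on word {w. mixed w \<and> trace (word w) \<le> T}"
    using word_inj by (auto simp: inj_on_def)
qed

lemma trace_uminus: "trace (- A) = - trace A" for A :: "int^2^2"
  by (simp add: trace_2)

lemma trace_word_pos: "trace (word w) > 0"
  using word_entries[of w] by (simp add: trace_2)

text \<open>Both sources of infinity in a set of bounded trace are harmless: conjugation moves the quasimorphism
by a bounded amount, and the infinitely many parabolic classes are words in one letter.\<close>
lemma brooks_bounded_trace:
  assumes W: "mixed W"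
  shows "\<exists>N. \<forall>A\<in>SL2Z. \<bar>trace A\<bar> \<le> T \<longrightarrow> \<bar>brooks W A\<bar> \<le> N"
proof -
  let ?F = "{w. mixed w \<and> trace (word w) \<le> T}"
  define N where "N = Max (insert 0 ((\<lambda>w. \<bar>count W w\<bar>) ` ?F))"
  have fin: "finite (insert 0 ((\<lambda>w. \<bar>count W w\<bar>) ` ?F))"
    using finite_mixed_words_bounded_trace by blast
  have N0: "N \<ge> 0"
    unfolding N_def using fin by (intro Max_ge) auto
  have N: "\<bar>count W w\<bar> \<le> N" if "trace (word w) \<le> T" for w
  proof (cases "mixed w")
    case True
    then show ?thesis
      unfolding N_def using fin that by (intro Max_ge) auto
  next
    case False
    then show ?thesis using count_not_mixed[OF W] N0 by simp
  qed
  have "\<bar>brooks W A\<bar> \<le> N + 18 * int (length W)" if A: "A \<in> SL2Z" "\<bar>trace A\<bar> \<le> T" for A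
  proof -
    obtain B where B: "conjugate_SL2Z A B" "cyclically_reduced B"
      using conjugate_cyclically_reduced[OF A(1)] .
    have tr: "\<bar>trace B\<bar> \<le> T"
      using conjugate_trace[OF B(1)] A by simp
    obtain v where v: "(B = word v \<or> B = - word v) \<or> length v \<le> 1 \<and> (B = S ** word v \<or> B = - (S ** word v))"
      using B(2) unfolding cyclically_reduced_def by blast
    then have "\<bar>brooks W B\<bar> \<le> N"
    proof
      assume Bv: "B = word v \<or> B = - word v"
      then have "brooks W B = count W v"
        using brooks_uminus[OF word_SL2Z] by (auto simp: brooks_eq[OF spells_word])
      moreover have "trace (word v) \<le> T"
        using Bv tr trace_word_pos[of v] by (auto simp: trace_uminus)
      ultimately show ?thesis using N by simp
    next
      assume Bv: "length v \<le> 1 \<and> (B = S ** word v \<or> B = - (S ** word v))"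
      have "brooks W B = count W v"
        using Bv brooks_eq[OF spells_S[OF spells_word]] brooks_eq[OF spells_uminus[OF spells_S[OF spells_word]]]
        by auto
      moreover have "\<not> mixed v"
        using Bv by (cases v) auto
      ultimately show ?thesis
        using count_not_mixed[OF W] N0 by simp
    qed
    then show ?thesis
      using brooks_conjugate[OF W A(1) B(1)] by linarith
  qed
  then show ?thesis by blast
qed

section \<open>Growth along the powers of a hyperbolic matrix\<close>

text \<open>Trace larger than 2 in absolute value rules out the elliptic shapes and the words in one letter.\<close>
lemma hyperbolic_conjugate_word:
  assumes "h \<in> SL2Z" "hyperbolic h"
  shows "\<exists>W. mixed W \<and> (conjugate_SL2Z h (word W) \<or> conjugate_SL2Z h (- word W))"
proof -
  obtain B where B: "conjugate_SL2Z h B" "cyclically_reduced B"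
    using conjugate_cyclically_reduced[OF assms(1)] .
  have tr: "\<bar>trace B\<bar> > 2"
    using conjugate_trace[OF B(1)] assms(2) by (simp add: hyperbolic_def)
  have "\<bar>trace (S ** word v)\<bar> \<le> 1" if "length v \<le> 1" for v
    using that by (cases v) (auto simp: trace_2 mult_entry S_def letter_def)
  then obtain v where v: "B = word v \<or> B = - word v"
    using B(2) tr unfolding cyclically_reduced_def by (fastforce simp: trace_uminus)
  have "mixed v"
  proof (rule ccontr)
    assume "\<not> mixed v"
    then have "word v $ 1 $ 2 = 0 \<or> word v $ 2 $ 1 = 0"
      using word_entry_12[of v] word_entry_21[of v] word_entries[of v] by (force simp: mixed_def)
    then have "word v $ 1 $ 1 * word v $ 2 $ 2 = 1"
      using word_SL2Z[of v] by (auto simp: SL2Z_iff)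
    then have "\<bar>trace (word v)\<bar> = 2"
      by (auto simp: trace_2 zmult_eq_1_iff)
    then show False using v tr by (auto simp: trace_uminus)
  qed
  then show ?thesis using v B(1) by blast
qed

lemma window_of_power_is_rotation:
  assumes "concat (replicate t W) = p @ V @ s" "length V = length W"
  shows "\<exists>a b. W = a @ b \<and> V = b @ a"
  using assms
proof (induction t arbitrary: p)
  case 0
  then show ?case by auto
next
  case (Suc t)
  let ?X = "concat (replicate t W)"
  have eq: "W @ ?X = p @ V @ s" using Suc.prems by simp
  then consider b where "W = p @ b" "b @ ?X = V @ s" | p' where "p = W @ p'" "?X = p' @ V @ s"
    by (auto simp: append_eq_append_conv2)
  then show ?case
  proof cases
    case 1
    from 1 have "length b \<le> length V" using Suc.prems by simp
    with 1(2) obtain a where a: "V = b @ a" "?X = a @ s"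
      by (auto simp: append_eq_append_conv2)
    then have len: "length a = length p" using 1 Suc.prems by simp
    have "a = p"
    proof (cases t)
      case 0
      then show ?thesis using a len by simp
    next
      case (Suc t')
      then have "a @ s = p @ (b @ concat (replicate t' W))"
        using a 1 by simp
      then show ?thesis using len by simp
    qed
    then show ?thesis using 1 a by blast
  next
    case 2
    then show ?thesis using Suc by blast
  qed
qed

lemma word_bar_conjugate_inv: "conjugate_SL2Z (word (bar w)) (matrix_inv (word w))"
proof -
  have "S ** word (bar w) ** matrix_inv S = matrix_inv (word w)"
    by (simp add: word_bar conj_S) (simp flip: matrix_mul_assoc)
  then show ?thesis
    unfolding conjugate_SL2Z_def by (auto intro: bexI[of _ S])
qed

text \<open>An occurrence of \<open>bar W\<close> in a power of \<open>W\<close> would be a rotation of \<open>W\<close>, and rotating a word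
conjugates its matrix; but \<open>bar W\<close> belongs to the conjugacy class of the inverse.\<close>
lemma count_power:
  assumes W: "W \<noteq> []" and nc: "\<not> conjugate_SL2Z (word W) (matrix_inv (word W))"
  shows "count W (concat (replicate t W)) \<ge> int t"
proof -
  have "occ W (concat (replicate t W)) \<ge> t"
  proof (induction t)
    case (Suc t)
    then show ?case
      using occ_append_ge[OF W, of W "concat (replicate t W)"] by (simp add: occ_self)
  qed simp
  moreover have "occ (bar W) (concat (replicate t W)) = 0"
  proof (rule ccontr)
    assume "occ (bar W) (concat (replicate t W)) \<noteq> 0"
    then obtain p s where "concat (replicate t W) = p @ bar W @ s"
      using occ_pos_imp by blast
    then obtain a b where ab: "W = a @ b" "bar W = b @ a"
      using window_of_power_is_rotation[of t W p "bar W" s] by auto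
    have "conjugate_SL2Z (word W) (word (bar W))"
      unfolding ab(2) unfolding ab(1) by (simp add: conjugate_mult_commute)
    then show False
      using nc word_bar_conjugate_inv conjugate_trans by blast
  qed
  ultimately show ?thesis by (simp add: count_def)
qed

lemma mat_pow_conjugate:
  assumes "conjugate_SL2Z A B"
  shows "conjugate_SL2Z (mat_pow A n) (mat_pow B n)"
proof -
  obtain g where g: "g \<in> SL2Z" "g ** A ** matrix_inv g = B"
    using assms unfolding conjugate_SL2Z_def by blast
  have "g ** mat_pow A n ** matrix_inv g = mat_pow B n"
  proof (induction n)
    case 0
    then show ?case using g(1) by simp
  next
    case (Suc n)
    have "g ** mat_pow A (Suc n) ** matrix_inv g
        = (g ** A ** matrix_inv g) ** (g ** mat_pow A n ** matrix_inv g)"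
      using g(1) by (simp flip: matrix_mul_assoc)
    also have "\<dots> = mat_pow B (Suc n)"
      unfolding g(2) Suc.IH by simp
    finally show ?case .
  qed
  then show ?thesis
    unfolding conjugate_SL2Z_def using g(1) by blast
qed

lemma mat_pow_word: "mat_pow (word W) t = word (concat (replicate t W))"
  by (induction t) auto

lemma mat_pow_uminus: "mat_pow (- A) t = mat_pow A t \<or> mat_pow (- A) t = - mat_pow A t"
  by (induction t) auto

proposition ex_quasimorphism:
  assumes h: "h \<in> SL2Z" "hyperbolic h" and nc: "\<not> conjugate_SL2Z h (matrix_inv h)"
  shows "\<exists>q :: int^2^2 \<Rightarrow> int. \<exists>K.
     (\<forall>A\<in>SL2Z. \<forall>B\<in>SL2Z. \<bar>q (A ** B) - q A - q B\<bar> \<le> K) \<and>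
     (\<forall>T. \<exists>N. \<forall>A\<in>SL2Z. \<bar>trace A\<bar> \<le> T \<longrightarrow> \<bar>q A\<bar> \<le> N) \<and>
     (\<forall>t. q (mat_pow h t) \<ge> int t - K)"
proof -
  obtain W where W: "mixed W" "conjugate_SL2Z h (word W) \<or> conjugate_SL2Z h (- word W)"
    using hyperbolic_conjugate_word[OF h] by blast
  have ne: "W \<noteq> []" using W(1) by auto
  have minv: "matrix_inv (- A) = - matrix_inv A" if "A \<in> SL2Z" for A
    using that by (simp add: matrix_inv_SL2Z mat_eq_iff)
  have nW: "\<not> conjugate_SL2Z (word W) (matrix_inv (word W))"
  proof
    assume *: "conjugate_SL2Z (word W) (matrix_inv (word W))"
    obtain B where B: "conjugate_SL2Z h B" "B = word W \<or> B = - word W"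
      using W(2) by blast
    have "conjugate_SL2Z B (matrix_inv B)"
      using B(2) * conjugate_uminus[OF *] by (auto simp: minv)
    moreover have "conjugate_SL2Z (matrix_inv B) (matrix_inv h)"
      using conjugate_inv[OF B(1) h(1)] conjugate_sym by blast
    ultimately show False
      using nc B(1) conjugate_trans by blast
  qed
  have growth: "brooks W (mat_pow h t) \<ge> int t - 18 * int (length W)" for t
  proof -
    obtain B where B: "conjugate_SL2Z h B" "B = word W \<or> B = - word W"
      using W(2) by blast
    have "brooks W (mat_pow B t) = count W (concat (replicate t W))"
      using B(2) mat_pow_uminus[of "word W" t] brooks_uminus[OF word_SL2Z]
      by (auto simp: mat_pow_word brooks_eq[OF spells_word])
    then show ?thesis
      using brooks_conjugate[OF W(1) SL2Z_mat_pow[OF h(1)] mat_pow_conjugate[OF B(1), of t]]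
        count_power[OF ne nW, of t] by linarith
  qed
  show ?thesis
  proof (rule exI[of _ "brooks W"], rule exI[of _ "18 * int (length W)"], intro conjI ballI allI)
    show "\<bar>brooks W (A ** B) - brooks W A - brooks W B\<bar> \<le> 18 * int (length W)"
      if "A \<in> SL2Z" "B \<in> SL2Z" for A B
      using brooks_mult[OF W(1) that] by simp
  qed (use growth brooks_bounded_trace[OF W(1)] in auto)
qed

section \<open>The torus and its characters\<close>

lemma torus_of_surj: "\<exists>x. t = torus_of x"
proof transfer
  show "\<exists>x. lattice_equiv t x" for t
    by (rule exI[of _ t]) (simp add: lattice_equiv_def)
qed

lemma torus_of_eq_iff: "torus_of x = torus_of y \<longleftrightarrow> lattice_equiv x y"
  by transfer simp

lemma torus_act_torus_of: "torus_act A (torus_of x) = torus_of (map_matrix real_of_int A *v x)"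
  by transfer (simp add: lattice_equiv_def)

lemma measurable_torus_iff: "F \<in> measurable torus_measure M \<longleftrightarrow> (\<lambda>x. F (torus_of x)) \<in> measurable borel M"
proof -
  have "torus_of -` F -` B = (\<lambda>x. F (torus_of x)) -` B" for B by auto
  moreover have "(\<forall>t. F t \<in> space M) \<longleftrightarrow> (\<forall>x. F (torus_of x) \<in> space M)"
    using torus_of_surj by metis
  ultimately show ?thesis
    by (auto simp: measurable_def sets_torus_measure Pi_iff)
qed

lemma measurable_torus_of [measurable]: "torus_of \<in> measurable borel torus_measure"
  using measurable_torus_iff[of id torus_measure] by (simp add: id_def)

lemma measurable_torus_act [measurable]: "torus_act A \<in> measurable torus_measure torus_measure"
proof -
  have "(\<lambda>x. torus_of (map_matrix real_of_int A *v x)) \<in> measurable borel torus_measure"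
    by (intro measurable_compose[OF _ measurable_torus_of] borel_measurable_continuous_onI
        linear_continuous_on matrix_vector_mul_bounded_linear)
  then show ?thesis
    by (simp add: measurable_torus_iff torus_act_torus_of)
qed

lemma unit_cell_borel [measurable]: "unit_cell \<in> sets borel"
proof -
  have "unit_cell = {x. 0 \<le> x $ 1 \<and> x $ 1 < 1 \<and> 0 \<le> x $ 2 \<and> x $ 2 < 1}"
    by (auto simp: unit_cell_def forall_2)
  also have "\<dots> \<in> sets borel"
    by measurable
  finally show ?thesis .
qed

lemma measurable_torus_of_cell: "torus_of \<in> measurable (restrict_space lborel unit_cell) torus_measure"
  by (rule measurable_restrict_space1) simp

lemma torus_measure_eq: "torus_measure = distr (restrict_space lborel unit_cell) torus_measure torus_of"
  unfolding torus_measure_def by (rule distr_cong) auto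

lemma integral_torus:
  fixes F :: "torus \<Rightarrow> 'b::{banach, second_countable_topology}"
  assumes "F \<in> borel_measurable torus_measure"
  shows "(\<integral>t. F t \<partial>torus_measure) = (\<integral>x. indicator unit_cell x *\<^sub>R F (torus_of x) \<partial>lborel)"
proof -
  have "(\<integral>t. F t \<partial>torus_measure) = (\<integral>x. F (torus_of x) \<partial>(restrict_space lborel unit_cell))"
    by (subst torus_measure_eq, rule integral_distr[OF measurable_torus_of_cell assms])
  also have "\<dots> = (\<integral>x. indicator unit_cell x *\<^sub>R F (torus_of x) \<partial>lborel)"
    by (rule integral_restrict_space) simp
  finally show ?thesis .
qed

lemma finite_torus_measure: "finite_measure torus_measure"
proof (rule finite_measureI)
  have "emeasure torus_measure (space torus_measure) = emeasure lborel unit_cell"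
    by (subst torus_measure_eq, subst emeasure_distr[OF measurable_torus_of_cell])
      (simp_all add: emeasure_restrict_space space_restrict_space sets_torus_measure)
  also have "\<dots> \<le> emeasure lborel (cbox 0 (1::real^2))"
    by (rule emeasure_mono) (auto simp: unit_cell_def mem_box_cart less_imp_le)
  also have "\<dots> < \<infinity>"
    by (rule emeasure_lborel_cbox_finite)
  finally show "emeasure torus_measure (space torus_measure) \<noteq> \<infinity>"
    by simp
qed

lift_definition character :: "int^2 \<Rightarrow> torus \<Rightarrow> complex"
  is "\<lambda>v x. cis (2 * pi * (\<Sum>i\<in>UNIV. real_of_int (v $ i) * x $ i))"
proof -
  fix v :: "int^2" and x y :: "real^2"
  assume "lattice_equiv x y"
  then have "(\<Sum>i\<in>UNIV. real_of_int (v $ i) * (x $ i - y $ i)) \<in> \<int>"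
    unfolding lattice_equiv_def by (auto intro!: Ints_sum Ints_mult)
  then have "cis (2 * pi * (\<Sum>i\<in>UNIV. real_of_int (v $ i) * (x $ i - y $ i))) = 1"
    by (rule cis_multiple_2pi)
  then show "cis (2 * pi * (\<Sum>i\<in>UNIV. real_of_int (v $ i) * x $ i))
    = cis (2 * pi * (\<Sum>i\<in>UNIV. real_of_int (v $ i) * y $ i))"
    by (simp add: right_diff_distrib sum_subtractf flip: cis_divide)
qed

lemma character_torus_of:
  "character v (torus_of x) = cis (2 * pi * (\<Sum>i\<in>UNIV. real_of_int (v $ i) * x $ i))"
  by transfer (rule refl)

lemma norm_character [simp]: "norm (character v t) = 1"
  by transfer simp

lemma character_0 [simp]: "character 0 t = 1"
  by transfer simp

lemma character_add: "character (v + w) t = character v t * character w t"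
  by transfer (simp add: cis_mult distrib_left distrib_right sum.distrib)

lemma character_uminus: "character (- v) t = cnj (character v t)"
  by transfer (simp add: cis_cnj sum_negf)

lemma character_torus_act: "character v (torus_act A t) = character (transpose A *v v) t"
proof -
  obtain x where x: "t = torus_of x" using torus_of_surj by blast
  have "(\<Sum>i\<in>UNIV. real_of_int (v $ i) * (map_matrix real_of_int A *v x) $ i)
      = (\<Sum>i\<in>UNIV. real_of_int ((transpose A *v v) $ i) * x $ i)"
    by (simp add: sum_2 matrix_vector_mult_def transpose_def algebra_simps)
  then show ?thesis
    unfolding x torus_act_torus_of character_torus_of by simp
qed

lemma measurable_character [measurable]: "character v \<in> borel_measurable torus_measure"
  unfolding measurable_torus_iff character_torus_of
  by (intro borel_measurable_continuous_onI continuous_intros)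

lemma integral_cis_period:
  assumes "k \<in> \<int>" "k \<noteq> 0"
  shows "integrable lborel (\<lambda>s. indicator {0..<1::real} s *\<^sub>R cis (2 * pi * k * s))" (is ?A)
    and "(\<integral>s. indicator {0..<1::real} s *\<^sub>R cis (2 * pi * k * s) \<partial>lborel) = 0" (is ?B)
proof -
  let ?F = "\<lambda>s. cis (2 * pi * k * s) / (\<i> * of_real (2 * pi * k))"
  have "(?F has_vector_derivative cis (2 * pi * k * s)) (at s within {0..1})" for s
  proof -
    let ?c = "\<i> * complex_of_real (2 * pi * k)"
    have "((\<lambda>z. exp (?c * z) / ?c) has_field_derivative exp (?c * of_real s)) (at (of_real s))"
      using assms(2) by (auto intro!: derivative_eq_intros)
    then have "((\<lambda>s. exp (?c * of_real s) / ?c) has_vector_derivative exp (?c * of_real s)) (at s within {0..1})"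
      by (rule has_vector_derivative_real_field)
    then show ?thesis
      by (simp add: cis_conv_exp mult.assoc)
  qed
  then have "has_bochner_integral lborel (\<lambda>s. indicator {0..1} s *\<^sub>R cis (2 * pi * k * s)) (?F 1 - ?F 0)"
    by (intro has_bochner_integral_FTC_Icc continuous_intros) auto
  moreover have "?F 1 - ?F 0 = 0"
    using cis_multiple_2pi[OF assms(1)] by simp
  ultimately have Icc: "has_bochner_integral lborel (\<lambda>s. indicator {0..1} s *\<^sub>R cis (2 * pi * k * s)) 0"
    by metis
  have [measurable]: "(\<lambda>s. cis (2 * pi * k * s)) \<in> borel_measurable borel"
    by (intro borel_measurable_continuous_onI continuous_intros)
  have "has_bochner_integral lborel (\<lambda>s. indicator {0..<1} s *\<^sub>R cis (2 * pi * k * s)) 0"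
  proof (rule has_bochner_integral_cong_AE[THEN iffD1, OF _ _ _ Icc])
    show "AE s in lborel. indicator {0..1} s *\<^sub>R cis (2 * pi * k * s) = indicator {0..<1} s *\<^sub>R cis (2 * pi * k * s)"
      using AE_lborel_singleton[of "1::real"] by eventually_elim (auto split: split_indicator)
  qed measurable
  then show ?A ?B
    by (auto simp: has_bochner_integral_iff)
qed

text \<open>Orthogonality of characters. Over the fundamental domain the integral factors into one integral for
each coordinate, and a nontrivial frequency in some coordinate makes that factor vanish.\<close>
lemma integral_character: "(\<integral>t. character v t \<partial>torus_measure) = (if v = 0 then 1 else 0)"
proof -
  define k where "k b = (\<chi> i. real_of_int (v $ i)) \<bullet> b" for b :: "real^2"
  define g where "g b s = indicator {0..<1::real} s *\<^sub>R cis (2 * pi * k b * s)" for b :: "real^2" and s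
  have axis: "(\<Prod>b\<in>Basis. G b) = G (axis 1 1) * G (axis 2 1)" for G :: "real^2 \<Rightarrow> complex"
    by (simp add: Basis_vec_def UNIV_2 axis_eq_axis)
  have k: "k (axis i 1) = of_int (v $ i)" for i
    by (simp add: k_def inner_axis)
  have int: "integrable lborel (g b)" "integral\<^sup>L lborel (g b) = (if k b = 0 then 1 else 0)" if b: "b \<in> Basis" for b
  proof -
    obtain i where "b = axis i 1" using b by (auto simp: Basis_vec_def)
    then have "k b \<in> \<int>" by (simp add: k)
    have 0: "g b = (\<lambda>s. indicator {0..<1} s *\<^sub>R 1)" if "k b = 0"
      using that by (auto simp: g_def)
    have "integrable lborel (\<lambda>s::real. indicator {0..<1} s *\<^sub>R (1::complex))"
      by simp
    then show "integrable lborel (g b)"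
      using 0 integral_cis_period(1)[OF \<open>k b \<in> \<int>\<close>] by (cases "k b = 0") (auto simp: g_def[abs_def])
    show "integral\<^sup>L lborel (g b) = (if k b = 0 then 1 else 0)"
      using 0 integral_cis_period(2)[OF \<open>k b \<in> \<int>\<close>] by (cases "k b = 0") (auto simp: g_def[abs_def])
  qed
  have "indicator unit_cell x *\<^sub>R character v (torus_of x) = (\<Prod>b\<in>Basis. g b (x \<bullet> b))" for x
    unfolding axis character_torus_of g_def k inner_axis
    by (auto simp: sum_2 cis_mult unit_cell_def forall_2 algebra_simps split: split_indicator)
  then have "(\<integral>t. character v t \<partial>torus_measure) = (\<integral>x. (\<Prod>b\<in>Basis. g b (x \<bullet> b)) \<partial>(lborel::(real^2) measure))"
    by (simp add: integral_torus)
  also have "\<dots> = (\<integral>f. (\<Prod>b\<in>Basis. g b (f b)) \<partial>(\<Pi>\<^sub>M b\<in>(Basis::(real^2) set). lborel))"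
  proof -
    have [measurable]: "g b \<in> borel_measurable borel" if "b \<in> Basis" for b
      using int(1)[OF that] by (auto dest: borel_measurable_integrable)
    show ?thesis
      by (subst lborel_eq, subst integral_distr) (auto intro!: Bochner_Integration.integral_cong prod.cong)
  qed
  also have "\<dots> = (\<Prod>b\<in>Basis. integral\<^sup>L lborel (g b))"
  proof -
    interpret product_sigma_finite "\<lambda>_::real^2. lborel :: real measure"
      by standard
    show ?thesis by (rule product_integral_prod) (use int in auto)
  qed
  also have "\<dots> = (\<Prod>b\<in>Basis. if k b = 0 then 1 else 0)"
    using int by (intro prod.cong) auto
  also have "\<dots> = (if v = 0 then 1 else 0)"
    unfolding axis k by (auto simp: vec_eq_iff forall_2)
  finally show ?thesis .
qed

interpretation torus: finite_measure torus_measure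
  by (rule finite_torus_measure)

section \<open>Functions generated by characters\<close>

text \<open>The functions generated by characters under linear combinations and bounded pointwise limits. They
turn out to be exactly the bounded measurable functions, and the induction rule then reduces
statements about those to characters.\<close>
inductive spectral :: "(torus \<Rightarrow> complex) \<Rightarrow> bool" where
  char: "spectral (character v)"
| add: "spectral F \<Longrightarrow> spectral G \<Longrightarrow> spectral (\<lambda>t. F t + G t)"
| scale: "spectral F \<Longrightarrow> spectral (\<lambda>t. c * F t)"
| lim: "(\<And>n. spectral (G n)) \<Longrightarrow> (\<And>n t. norm (G n t) \<le> B) \<Longrightarrow> (\<And>t. (\<lambda>n. G n t) \<longlonglongrightarrow> F t) \<Longrightarrow> spectral F"

lemma spectral_measurable: "spectral F \<Longrightarrow> F \<in> borel_measurable torus_measure"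
proof (induction rule: spectral.induct)
  case (char v)
  show ?case by (rule measurable_character)
next
  case (add F G)
  show ?case by (rule borel_measurable_add[OF add.IH])
next
  case (scale F c)
  show ?case by (rule borel_measurable_times[OF borel_measurable_const scale.IH])
next
  case (lim G B F)
  show ?case by (rule borel_measurable_LIMSEQ_metric[OF lim.IH lim.hyps(3)])
qed

lemma spectral_bounded: "spectral F \<Longrightarrow> \<exists>B. \<forall>t. norm (F t) \<le> B"
proof (induction rule: spectral.induct)
  case (char v)
  then show ?case by (intro exI[of _ 1]) auto
next
  case (add F G)
  then obtain B C where "\<forall>t. norm (F t) \<le> B" "\<forall>t. norm (G t) \<le> C" by blast
  then have "\<forall>t. norm (F t + G t) \<le> B + C" by (simp add: norm_triangle_mono)
  then show ?case by blast
next
  case (scale F c)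
  then obtain B where "\<forall>t. norm (F t) \<le> B" by blast
  then have "\<forall>t. norm (c * F t) \<le> norm c * B" by (simp add: norm_mult mult_left_mono)
  then show ?case by blast
next
  case (lim G B F)
  have "norm (F t) \<le> B" for t
    by (rule Lim_bounded[OF tendsto_norm[OF lim.hyps(3)], of 0]) (use lim.hyps(2) in simp)
  then show ?case by blast
qed

lemma spectral_const: "spectral (\<lambda>_. c)"
  using scale[OF char[of 0], of c] by simp

lemma spectral_diff: "spectral F \<Longrightarrow> spectral G \<Longrightarrow> spectral (\<lambda>t. F t - G t)"
  using add[OF _ scale[of G "-1"], of F] by simp

lemma spectral_sum:
  assumes "\<And>i. i \<in> I \<Longrightarrow> spectral (F i)"
  shows "spectral (\<lambda>t. \<Sum>i\<in>I. F i t)"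
  using assms
  by (induction I rule: infinite_finite_induct) (auto intro: spectral_const add)

lemma spectral_mult:
  assumes "spectral F" "spectral G"
  shows "spectral (\<lambda>t. F t * G t)"
proof -
  have char_mult: "spectral (\<lambda>t. character v t * G t)" if "spectral G" for v G
    using that
  proof (induction rule: spectral.induct)
    case (char w)
    then show ?case using spectral.char[of "v + w"] by (simp add: character_add[abs_def])
  next
    case (add F G)
    show ?case using spectral.add[OF add.IH] by (simp add: distrib_left)
  next
    case (scale F c)
    then show ?case using spectral.scale[OF scale.IH, of c] by (simp add: mult.left_commute)
  next
    case (lim G B F)
    show ?case
    proof (rule spectral.lim[where B = B])
      show "spectral (\<lambda>t. character v t * G n t)" for n using lim.IH .
      show "norm (character v t * G n t) \<le> B" for n t using lim.hyps(2) by (simp add: norm_mult)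
      show "(\<lambda>n. character v t * G n t) \<longlonglongrightarrow> character v t * F t" for t
        by (intro tendsto_intros lim.hyps)
    qed
  qed
  show ?thesis using assms(1)
  proof (induction rule: spectral.induct)
    case (char v)
    then show ?case using char_mult assms(2) .
  next
    case (add F G)
    show ?case using spectral.add[OF add.IH] by (simp add: distrib_right)
  next
    case (scale F c)
    then show ?case using spectral.scale[OF scale.IH, of c] by (simp add: mult.assoc)
  next
    case (lim H B F)
    obtain C where C: "\<forall>t. norm (G t) \<le> C" using spectral_bounded assms(2) by blast
    show ?case
    proof (rule spectral.lim[where B = "B * C"])
      show "spectral (\<lambda>t. H n t * G t)" for n using lim.IH .
      show "norm (H n t * G t) \<le> B * C" for n t
      proof -
        have "0 \<le> B" using lim.hyps(2)[of n t] norm_ge_zero order_trans by blast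
        then show ?thesis
          using lim.hyps(2)[of n t] C by (simp add: norm_mult mult_mono)
      qed
      show "(\<lambda>n. H n t * G t) \<longlonglongrightarrow> F t * G t" for t
        by (intro tendsto_intros lim.hyps)
    qed
  qed
qed

text \<open>The embedding of the torus in \<open>\<complex>\<^sup>2\<close>, where compactness and the Borel structure are available.\<close>
definition circles :: "torus \<Rightarrow> complex \<times> complex" where
  "circles t = (character (axis 1 1) t, character (axis 2 1) t)"

abbreviation unit_circles :: "(complex \<times> complex) set" where
  "unit_circles \<equiv> sphere 0 1 \<times> sphere 0 1"

lemma circles_in: "circles t \<in> unit_circles"
  by (simp add: circles_def dist_norm)

lemma spectral_Re_Im_character:
  "spectral (\<lambda>t. of_real (Re (character v t)))" "spectral (\<lambda>t. of_real (Im (character v t)))"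
proof -
  have "(\<lambda>t. of_real (Re (character v t))) = (\<lambda>t. (1/2) * (character v t + character (- v) t))"
    by (auto simp: character_uminus complex_eq_iff)
  then show "spectral (\<lambda>t. of_real (Re (character v t)))"
    using scale[OF add[OF char[of v] char[of "- v"]], of "1/2"] by simp
  have "(\<lambda>t. of_real (Im (character v t))) = (\<lambda>t. (- \<i> / 2) * (character v t - character (- v) t))"
    by (auto simp: character_uminus complex_eq_iff)
  then show "spectral (\<lambda>t. of_real (Im (character v t)))"
    using scale[OF spectral_diff[OF char[of v] char[of "- v"]], of "- \<i> / 2"] by simp
qed

text \<open>Stone--Weierstrass: the real functions on the product of circles whose pullback to the torus is
\<open>spectral\<close> form an algebra that separates points.\<close>
lemma spectral_continuous:
  fixes f :: "complex \<times> complex \<Rightarrow> real"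
  assumes f: "continuous_on unit_circles f"
  shows "spectral (\<lambda>t. of_real (f (circles t)))"
proof -
  let ?R = "{f :: complex \<times> complex \<Rightarrow> real. continuous_on unit_circles f \<and> spectral (\<lambda>t. of_real (f (circles t)))}"
  interpret function_ring_on ?R unit_circles
  proof
    show "compact unit_circles" by (intro compact_Times) auto
    fix x y :: "complex \<times> complex"
    assume xy: "x \<in> unit_circles" "y \<in> unit_circles" "x \<noteq> y"
    have R: "(\<lambda>x. Re (fst x)) \<in> ?R" "(\<lambda>x. Im (fst x)) \<in> ?R" "(\<lambda>x. Re (snd x)) \<in> ?R" "(\<lambda>x. Im (snd x)) \<in> ?R"
      by (auto simp: circles_def intro!: spectral_Re_Im_character continuous_intros)
    from xy(3) consider "Re (fst x) \<noteq> Re (fst y)" | "Im (fst x) \<noteq> Im (fst y)"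
      | "Re (snd x) \<noteq> Re (snd y)" | "Im (snd x) \<noteq> Im (snd y)"
      by (auto simp: prod_eq_iff complex_eq_iff)
    then show "\<exists>f\<in>?R. f x \<noteq> f y"
    proof cases
      case 1
      then show ?thesis by (rule bexI[OF _ R(1)])
    next
      case 2
      then show ?thesis by (rule bexI[OF _ R(2)])
    next
      case 3
      then show ?thesis by (rule bexI[OF _ R(3)])
    next
      case 4
      then show ?thesis by (rule bexI[OF _ R(4)])
    qed
  next
    fix f g assume fg: "f \<in> ?R" "g \<in> ?R"
    show "(\<lambda>x. f x + g x) \<in> ?R" "(\<lambda>x. f x * g x) \<in> ?R"
      using fg add[of "\<lambda>t. of_real (f (circles t))" "\<lambda>t. of_real (g (circles t))"]
        spectral_mult[of "\<lambda>t. of_real (f (circles t))" "\<lambda>t. of_real (g (circles t))"]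
      by (auto intro: continuous_on_add continuous_on_mult)
  qed (auto intro: spectral_const)
  obtain g where g: "\<And>n::nat. g n \<in> ?R" "\<And>n x. x \<in> unit_circles \<Longrightarrow> \<bar>f x - g n x\<bar> < inverse (Suc n)"
    
  proof -
    have "\<exists>g\<in>?R. \<forall>x\<in>unit_circles. \<bar>f x - g x\<bar> < inverse (Suc n)" for n :: nat
      by (rule Stone_Weierstrass_basic[OF f]) simp
    then have "\<exists>g. \<forall>n::nat. g n \<in> ?R \<and> (\<forall>x\<in>unit_circles. \<bar>f x - g n x\<bar> < inverse (Suc n))"
      by (intro choice) blast
    then show thesis using that by blast
  qed
  have "compact (f ` unit_circles)"
    by (intro compact_continuous_image[OF f] compact_Times) auto
  then have "bounded (f ` unit_circles)"
    by (rule compact_imp_bounded)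
  then obtain B where "\<forall>y\<in>f ` unit_circles. norm y \<le> B"
    unfolding bounded_iff by blast
  then have B: "\<bar>f x\<bar> \<le> B" if "x \<in> unit_circles" for x
    using that by (metis imageI real_norm_def)
  show ?thesis
  proof (rule lim[where B = "B + 1"])
    show "spectral (\<lambda>t. of_real (g n (circles t)))" for n
      using g(1)[of n] by simp
    show "norm (complex_of_real (g n (circles t))) \<le> B + 1" for n t
    proof -
      have "inverse (real (Suc n)) \<le> 1" by (simp add: field_simps)
      then show ?thesis
        using g(2)[OF circles_in, of t n] B[OF circles_in, of t] by simp
    qed
    show "(\<lambda>n. complex_of_real (g n (circles t))) \<longlonglongrightarrow> of_real (f (circles t))" for t
    proof (intro tendsto_of_real LIMSEQ_I)
      fix r :: real assume "r > 0"
      then obtain N where N: "inverse (real (Suc N)) < r" using reals_Archimedean by blast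
      have "\<bar>g n (circles t) - f (circles t)\<bar> < r" if "n \<ge> N" for n
      proof -
        have "inverse (real (Suc n)) \<le> inverse (real (Suc N))" using that by (simp add: field_simps)
        then show ?thesis using g(2)[OF circles_in, of t n] N by linarith
      qed
      then show "\<exists>N. \<forall>n\<ge>N. norm (g n (circles t) - f (circles t)) < r" by auto
    qed
  qed
qed

text \<open>The indicator of an open set is the increasing limit of the continuous functions
\<open>min 1 (n * infdist x (- U))\<close>. The whole space is a separate case because \<open>infdist\<close> to the empty
set is 0 by convention.\<close>
lemma spectral_open:
  assumes "open U"
  shows "spectral (\<lambda>t. indicator U (circles t))"
proof (cases "U = UNIV")
  case True
  then show ?thesis using spectral_const[of 1] by simp
next
  case False
  let ?f = "\<lambda>n x. min 1 (real n * infdist x (- U))"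
  show ?thesis
  proof (rule lim[where B = 1])
    show "spectral (\<lambda>t. of_real (?f n (circles t)))" for n
      by (intro spectral_continuous continuous_intros)
    show "norm (complex_of_real (?f n (circles t))) \<le> 1" for n t
    proof -
      have "0 \<le> real n * infdist (circles t) (- U)" by (simp add: infdist_nonneg)
      then show ?thesis unfolding norm_of_real by linarith
    qed
    show "(\<lambda>n. complex_of_real (?f n (circles t))) \<longlonglongrightarrow> indicator U (circles t)" for t
    proof (cases "circles t \<in> U")
      case True
      have "infdist (circles t) (- U) > 0"
        using True False assms infdist_pos_not_in_closed[of "- U" "circles t"] by auto
      then obtain N where N: "real N * infdist (circles t) (- U) > 1"
        using reals_Archimedean3 by blast
      have "?f n (circles t) = 1" if "n \<ge> N" for n
      proof -
        have "real N * infdist (circles t) (- U) \<le> real n * infdist (circles t) (- U)"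
          using that by (intro mult_right_mono) (auto simp: infdist_nonneg)
        then show ?thesis using N by simp
      qed
      then have "\<forall>\<^sub>F n in sequentially. complex_of_real (?f n (circles t)) = 1"
        unfolding eventually_sequentially by (metis of_real_1)
      then show ?thesis using True by (simp add: tendsto_eventually)
    next
      case False
      then have "infdist (circles t) (- U) = 0" by simp
      then show ?thesis using False by simp
    qed
  qed
qed

lemma spectral_borel:
  assumes "B \<in> sets borel"
  shows "spectral (\<lambda>t. indicator B (circles t))"
proof -
  have "Int_stable (Collect open :: (complex \<times> complex) set set)"
    by (auto simp: Int_stable_def)
  moreover have "(Collect open :: (complex \<times> complex) set set) \<subseteq> Pow UNIV"
    by simp
  moreover have "B \<in> sigma_sets UNIV (Collect open)"
    using assms by (simp add: borel_def)
  ultimately show ?thesis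
  proof (induction rule: sigma_sets_induct_disjoint)
    case (basic A)
    then show ?case by (simp add: spectral_open)
  next
    case empty
    then show ?case using spectral_const[of 0] by simp
  next
    case (compl A)
    have "(\<lambda>t. indicator (UNIV - A) (circles t)) = (\<lambda>t. 1 - indicator A (circles t) :: complex)"
      by (auto simp: fun_eq_iff split: split_indicator)
    then show ?case
      using spectral_diff[OF spectral_const[of 1] compl.IH] by simp
  next
    case (union A)
    let ?S = "\<lambda>n t. \<Sum>i<n. indicator (A i) (circles t) :: complex"
    have S: "?S n t = indicator (\<Union>i<n. A i) (circles t)" for n t
      using union(1) by (subst indicator_UN_disjoint) (auto intro: disjoint_family_on_mono)
    show ?case
    proof (rule lim[where B = 1])
      show "spectral (?S n)" for n
        using union.IH by (intro spectral_sum)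
      show "norm (?S n t) \<le> 1" for n t
        unfolding S by (simp split: split_indicator)
      show "(\<lambda>n. ?S n t) \<longlonglongrightarrow> indicator (\<Union>i. A i) (circles t)" for t
        unfolding S by (rule LIMSEQ_indicator_UN)
    qed
  qed
qed

text \<open>A measurable left inverse of the embedding, up to lattice translations. It turns a measurable set of the torus into the preimage of a
Borel set of \<open>\<complex>\<^sup>2\<close>.\<close>
definition uncircles :: "complex \<times> complex \<Rightarrow> real^2" where
  "uncircles z = (Arg (fst z) / (2 * pi)) *\<^sub>R axis 1 1 + (Arg (snd z) / (2 * pi)) *\<^sub>R axis 2 1"

text \<open>\<open>Arg\<close> is continuous off the closed negative real axis and equal to \<open>pi\<close> on it, except at 0.\<close>
lemma borel_measurable_Arg [measurable]: "Arg \<in> borel_measurable borel"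
proof -
  have eq: "Arg = (\<lambda>z. if z \<in> \<real>\<^sub>\<le>\<^sub>0 then (if z = 0 then 0 else pi) else Arg z)"
  proof (rule ext)
    fix z :: complex
    have "Arg z = pi" if "z \<in> \<real>\<^sub>\<le>\<^sub>0" "z \<noteq> 0"
      using that by (auto simp: complex_nonpos_Reals_iff complex_eq_iff Arg_eq_pi)
    then show "Arg z = (if z \<in> \<real>\<^sub>\<le>\<^sub>0 then (if z = 0 then 0 else pi) else Arg z)"
      by (simp add: Arg_zero)
  qed
  have [measurable]: "(\<real>\<^sub>\<le>\<^sub>0 :: complex set) \<in> sets borel"
    by (rule borel_closed) (rule closed_nonpos_Reals_complex)
  have "Arg \<in> borel_measurable (restrict_space borel {z. z \<notin> \<real>\<^sub>\<le>\<^sub>0})"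
    by (rule borel_measurable_continuous_on_restrict)
      (use continuous_on_Arg in \<open>simp add: Compl_eq\<close>)
  then show ?thesis
    by (subst eq, subst measurable_If_restrict_space_iff) (auto intro: measurable_restrict_space1)
qed

lemma measurable_uncircles [measurable]: "uncircles \<in> borel_measurable borel"
  unfolding uncircles_def borel_prod[symmetric] by measurable

lemma torus_of_uncircles: "torus_of (uncircles (circles t)) = t"
proof -
  obtain x where x: "t = torus_of x" using torus_of_surj by blast
  have *: "Arg (cis (2 * pi * a)) / (2 * pi) - a \<in> \<int>" for a
  proof -
    have "cis (Arg (cis (2 * pi * a))) = cis (2 * pi * a)"
      by (simp add: cis_Arg)
    then obtain n :: int where "Arg (cis (2 * pi * a)) = 2 * pi * a + 2 * pi * n"
      using sin_cos_eq_iff by (auto simp: complex_eq_iff)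
    then have "Arg (cis (2 * pi * a)) / (2 * pi) - a = of_int n"
      by (simp add: field_simps)
    then show ?thesis by simp
  qed
  have "character (axis i 1) t = cis (2 * pi * x $ i)" for i
    using exhaust_2[of i] unfolding x character_torus_of
    by (auto simp: sum_2 axis_def)
  then have "lattice_equiv (uncircles (circles t)) x"
    unfolding lattice_equiv_def uncircles_def circles_def forall_2
    using * by (simp add: axis_def)
  then show ?thesis
    unfolding x torus_of_eq_iff by simp
qed

lemma spectral_indicator:
  assumes "B \<in> sets torus_measure"
  shows "spectral (indicator B)"
proof -
  have m: "(\<lambda>z. torus_of (uncircles z)) \<in> measurable borel torus_measure"
    by (rule measurable_compose[OF measurable_uncircles measurable_torus_of])
  have "(\<lambda>z. torus_of (uncircles z)) -` B \<in> sets borel"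
    using measurable_sets[OF m assms] by simp
  then have "spectral (\<lambda>t. indicator ((\<lambda>z. torus_of (uncircles z)) -` B) (circles t))"
    by (rule spectral_borel)
  then show ?thesis
    by (simp add: indicator_def[abs_def] torus_of_uncircles)
qed

lemma spectral_bounded_measurable:
  assumes F: "F \<in> borel_measurable torus_measure" and B: "\<And>t. norm (F t) \<le> B"
  shows "spectral F"
proof -
  obtain s where s: "\<And>i. simple_function torus_measure (s i)" "\<And>t. (\<lambda>i. s i t) \<longlonglongrightarrow> F t"
    "\<And>i t. norm (s i t) \<le> 2 * norm (F t)"
    using borel_measurable_implies_sequence_metric[OF F, of 0] by auto
  show ?thesis
  proof (rule lim[OF _ _ s(2)])
    show "norm (s i t) \<le> 2 * B" for i t
      using s(3)[of i t] B[of t] by linarith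
    show "spectral (s i)" for i
    proof -
      have fin: "finite (range (s i))"
        using s(1)[of i] by (simp add: simple_function_def)
      have "s i t = (\<Sum>y\<in>range (s i). y * indicator (s i -` {y}) t)" for t
      proof -
        have "(\<Sum>y\<in>range (s i). y * indicator (s i -` {y}) t) = (\<Sum>y\<in>range (s i). if y = s i t then y else 0)"
          by (intro sum.cong) (auto simp: indicator_def)
        also have "\<dots> = s i t"
          using fin by (subst sum.delta) auto
        finally show ?thesis by simp
      qed
      then have eq: "s i = (\<lambda>t. \<Sum>y\<in>range (s i). y * indicator (s i -` {y}) t)"
        by (rule ext)
      have "s i -` {y} \<in> sets torus_measure" for y
        using simple_functionD(2)[OF s(1)[of i], of "{y}"] by simp
      then show ?thesis
        by (subst eq) (intro spectral_sum scale spectral_indicator)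
    qed
  qed
qed

lemma spectral_integrable: "spectral F \<Longrightarrow> integrable torus_measure F"
  using spectral_bounded[of F] spectral_measurable[of F]
  by (auto intro: torus.integrable_const_bound)

lemma transpose_mult_eq_0:
  assumes "A \<in> SL2Z" "transpose A *v v = 0"
  shows "v = (0 :: int^2)"
proof -
  have 1: "A $ 1 $ 1 * v $ 1 + A $ 2 $ 1 * v $ 2 = 0" and 2: "A $ 1 $ 2 * v $ 1 + A $ 2 $ 2 * v $ 2 = 0"
    using assms(2) by (simp_all add: vec_eq_iff forall_2 matrix_vector_mult_def sum_2)
  have det: "A $ 1 $ 1 * A $ 2 $ 2 - A $ 1 $ 2 * A $ 2 $ 1 = 1"
    using assms(1) by (simp add: SL2Z_iff)
  have "v $ 1 = 0" "v $ 2 = 0"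
    using 1 2 det by algebra+
  then show ?thesis by (simp add: vec_eq_iff forall_2)
qed

section \<open>Correlations of square integrable functions\<close>

text \<open>Invariance of the measure needs no change of variables in the plane: the action permutes the
characters and keeps the nontrivial ones nontrivial, so it holds for characters and passes to limits.\<close>
lemma integral_spectral_torus_act:
  assumes A: "A \<in> SL2Z" and F: "spectral F"
  shows "(\<integral>t. F (torus_act A t) \<partial>torus_measure) = (\<integral>t. F t \<partial>torus_measure)"
proof -
  have int: "integrable torus_measure (\<lambda>t. F (torus_act A t))" if "spectral F" for F
  proof -
    obtain B where "\<forall>t. norm (F t) \<le> B" using spectral_bounded[OF \<open>spectral F\<close>] by blast
    then show ?thesis
      using measurable_compose[OF measurable_torus_act spectral_measurable[OF \<open>spectral F\<close>]]
      by (intro torus.integrable_const_bound[of _ B]) auto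
  qed
  show ?thesis using F
  proof (induction rule: spectral.induct)
    case (char v)
    then show ?case
      using transpose_mult_eq_0[OF A, of v]
      by (auto simp: character_torus_act integral_character)
  next
    case (add F G)
    then show ?case
      by (simp add: Bochner_Integration.integral_add int spectral_integrable)
  next
    case (scale F c)
    then show ?case by simp
  next
    case (lim G B F)
    note m = spectral_measurable[OF lim.hyps(1)]
    note mF = borel_measurable_LIMSEQ_metric[OF m lim.hyps(3)]
    have "(\<lambda>n. \<integral>t. G n (torus_act A t) \<partial>torus_measure) \<longlonglongrightarrow> (\<integral>t. F (torus_act A t) \<partial>torus_measure)"
      by (rule integral_dominated_convergence[where w = "\<lambda>_. B"])
        (use lim.hyps m mF in \<open>auto intro: measurable_compose[OF measurable_torus_act]\<close>)
    moreover have "(\<lambda>n. \<integral>t. G n t \<partial>torus_measure) \<longlonglongrightarrow> (\<integral>t. F t \<partial>torus_measure)"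
      by (rule integral_dominated_convergence[where w = "\<lambda>_. B"])
        (use lim.hyps m mF in auto)
    ultimately show ?case
      unfolding lim.IH by (rule LIMSEQ_unique)
  qed
qed

lemma distr_torus_act:
  assumes A: "A \<in> SL2Z"
  shows "distr torus_measure torus_measure (torus_act A) = torus_measure"
proof (rule measure_eqI)
  fix B assume "B \<in> sets (distr torus_measure torus_measure (torus_act A))"
  then have B: "B \<in> sets torus_measure" by simp
  have B': "torus_act A -` B \<in> sets torus_measure"
    using measurable_sets[OF measurable_torus_act B, of A] by simp
  have m: "complex_of_real (measure torus_measure C) = (\<integral>t. indicator C t \<partial>torus_measure)"
    if "C \<in> sets torus_measure" for C
  proof -
    have "(\<integral>t. indicator C t \<partial>torus_measure) = (\<integral>t. complex_of_real (indicator C t) \<partial>torus_measure)"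
      by (intro Bochner_Integration.integral_cong) (auto split: split_indicator)
    also have "\<dots> = complex_of_real (measure torus_measure C)"
      using that by (simp only: integral_complex_of_real) simp
    finally show ?thesis by simp
  qed
  have "complex_of_real (measure torus_measure (torus_act A -` B)) = (\<integral>t. indicator B (torus_act A t) \<partial>torus_measure)"
    unfolding m[OF B'] by (intro Bochner_Integration.integral_cong) (auto simp: indicator_def)
  also have "\<dots> = complex_of_real (measure torus_measure B)"
    unfolding m[OF B] by (rule integral_spectral_torus_act[OF A spectral_indicator[OF B]])
  finally have "measure torus_measure (torus_act A -` B) = measure torus_measure B"
    by simp
  then show "emeasure (distr torus_measure torus_measure (torus_act A)) B = emeasure torus_measure B"
    using B by (simp add: emeasure_distr torus.emeasure_eq_measure)
qed simp

lemma integral_torus_act: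
  fixes f :: "torus \<Rightarrow> 'b::{banach, second_countable_topology}"
  assumes "A \<in> SL2Z" "f \<in> borel_measurable torus_measure"
  shows "(\<integral>t. f (torus_act A t) \<partial>torus_measure) = (\<integral>t. f t \<partial>torus_measure)"
  using integral_distr[OF measurable_torus_act assms(2), of A] by (simp add: distr_torus_act[OF assms(1)])

lemma integrable_torus_act:
  fixes f :: "torus \<Rightarrow> 'b::{banach, second_countable_topology}"
  assumes "A \<in> SL2Z" "integrable torus_measure f"
  shows "integrable torus_measure (\<lambda>t. f (torus_act A t))"
  using integrable_distr_eq[OF measurable_torus_act[of A] borel_measurable_integrable[OF assms(2)]] assms
  by (simp add: distr_torus_act)

lemma L2D:
  assumes "F \<in> L2_torus"
  shows "F \<in> borel_measurable torus_measure" "integrable torus_measure (\<lambda>t. (norm (F t))\<^sup>2)"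
  using assms by (auto simp: L2_torus_def)

lemma L2_torus_act:
  assumes "A \<in> SL2Z" "F \<in> L2_torus"
  shows "(\<lambda>t. F (torus_act A t)) \<in> L2_torus"
  using integrable_torus_act[OF assms(1) L2D(2)[OF assms(2)]]
    measurable_compose[OF measurable_torus_act L2D(1)[OF assms(2)]]
  by (simp add: L2_torus_def)

lemma L2_mult_integrable:
  assumes "F \<in> L2_torus" "G \<in> L2_torus"
  shows "integrable torus_measure (\<lambda>t. F t * G t)"
proof (rule Bochner_Integration.integrable_bound)
  show "integrable torus_measure (\<lambda>t. (norm (F t))\<^sup>2 + (norm (G t))\<^sup>2)"
    using assms by (auto dest: L2D)
  show "(\<lambda>t. F t * G t) \<in> borel_measurable torus_measure"
    using assms by (intro borel_measurable_times L2D)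
  have "norm (F t * G t) \<le> (norm (F t))\<^sup>2 + (norm (G t))\<^sup>2" for t
  proof -
    have "2 * (norm (F t) * norm (G t)) \<le> (norm (F t))\<^sup>2 + (norm (G t))\<^sup>2"
      using sum_squares_bound[of "norm (F t)" "norm (G t)"] by (simp add: mult.assoc)
    moreover have "0 \<le> norm (F t) * norm (G t)" by simp
    ultimately show ?thesis unfolding norm_mult by linarith
  qed
  then show "AE t in torus_measure. norm (F t * G t) \<le> norm ((norm (F t))\<^sup>2 + (norm (G t))\<^sup>2)"
    by simp
qed

lemma spectral_L2: 
  assumes "spectral F" shows "F \<in> L2_torus"
proof -
  obtain B where B: "\<forall>t. norm (F t) \<le> B" using spectral_bounded[OF assms] by blast
  have "integrable torus_measure (\<lambda>t. (norm (F t))\<^sup>2)"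
    using spectral_measurable[OF assms] B
    by (intro torus.integrable_const_bound[of _ "B\<^sup>2"]) (auto intro!: power_mono)
  then show ?thesis
    using spectral_measurable[OF assms] by (simp add: L2_torus_def)
qed

lemma L2_integrable:
  assumes "F \<in> L2_torus"
  shows "integrable torus_measure F"
  using L2_mult_integrable[OF assms spectral_L2[OF spectral_const[of 1]]] by simp

lemma L2_diff:
  assumes "F \<in> L2_torus" "G \<in> L2_torus"
  shows "(\<lambda>t. F t - G t) \<in> L2_torus"
proof -
  have "integrable torus_measure (\<lambda>t. (norm (F t - G t))\<^sup>2)"
  proof (rule Bochner_Integration.integrable_bound)
    show "integrable torus_measure (\<lambda>t. 2 * (norm (F t))\<^sup>2 + 2 * (norm (G t))\<^sup>2)"
      using L2D(2)[OF assms(1)] L2D(2)[OF assms(2)] by simp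
    show "(\<lambda>t. (norm (F t - G t))\<^sup>2) \<in> borel_measurable torus_measure"
    proof -
      have [measurable]: "F \<in> borel_measurable torus_measure" "G \<in> borel_measurable torus_measure"
        using assms L2D(1) by blast+
      show ?thesis by measurable
    qed
    have "(norm (F t - G t))\<^sup>2 \<le> 2 * (norm (F t))\<^sup>2 + 2 * (norm (G t))\<^sup>2" for t
    proof -
      have "(norm (F t - G t))\<^sup>2 \<le> (norm (F t) + norm (G t))\<^sup>2"
        by (intro power_mono norm_triangle_ineq4) simp
      also have "\<dots> \<le> 2 * (norm (F t))\<^sup>2 + 2 * (norm (G t))\<^sup>2"
        using sum_squares_bound[of "norm (F t)" "norm (G t)"] by (simp add: power2_sum)
      finally show ?thesis .
    qed
    then show "AE t in torus_measure. norm ((norm (F t - G t))\<^sup>2) \<le> norm (2 * (norm (F t))\<^sup>2 + 2 * (norm (G t))\<^sup>2)"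
      by simp
  qed
  then show ?thesis
    using borel_measurable_diff[OF L2D(1)[OF assms(1)] L2D(1)[OF assms(2)]] by (simp add: L2_torus_def)
qed

text \<open>The inequality of Cauchy and Schwarz with a free weight \<open>d\<close>. The weighted form makes the limit
arguments below linear in the squared norms.\<close>
lemma norm_integral_mult_le:
  assumes F: "F \<in> L2_torus" and G: "G \<in> L2_torus" and d: "d > 0"
  shows "norm (\<integral>t. F t * G t \<partial>torus_measure)
    \<le> (d * (\<integral>t. (norm (F t))\<^sup>2 \<partial>torus_measure) + (\<integral>t. (norm (G t))\<^sup>2 \<partial>torus_measure) / d) / 2"
proof -
  have int: "integrable torus_measure (\<lambda>t. (d * (norm (F t))\<^sup>2 + (norm (G t))\<^sup>2 / d) / 2)"
    using L2D(2)[OF F] L2D(2)[OF G] by simp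
  have "norm (F t * G t) \<le> (d * (norm (F t))\<^sup>2 + (norm (G t))\<^sup>2 / d) / 2" for t
  proof -
    have "0 \<le> (d * norm (F t) - norm (G t))\<^sup>2 / d" using d by simp
    also have "\<dots> = d * (norm (F t))\<^sup>2 + (norm (G t))\<^sup>2 / d - 2 * (norm (F t) * norm (G t))"
      using d by (simp add: power2_eq_square field_simps)
    finally show ?thesis by (simp add: norm_mult)
  qed
  then have "(\<integral>t. norm (F t * G t) \<partial>torus_measure) \<le> (\<integral>t. (d * (norm (F t))\<^sup>2 + (norm (G t))\<^sup>2 / d) / 2 \<partial>torus_measure)"
    by (intro Bochner_Integration.integral_mono integrable_norm L2_mult_integrable F G int)
  then have "norm (\<integral>t. F t * G t \<partial>torus_measure) \<le> (\<integral>t. (d * (norm (F t))\<^sup>2 + (norm (G t))\<^sup>2 / d) / 2 \<partial>torus_measure)"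
    by (rule order_trans[OF integral_norm_bound])
  also have "\<dots> = (d * (\<integral>t. (norm (F t))\<^sup>2 \<partial>torus_measure) + (\<integral>t. (norm (G t))\<^sup>2 \<partial>torus_measure) / d) / 2"
    using F G by (simp add: L2D)
  finally show ?thesis .
qed

lemma norm_integral_square_le:
  assumes F: "F \<in> L2_torus"
  shows "(norm (\<integral>t. F t \<partial>torus_measure))\<^sup>2 \<le> (\<integral>t. (norm (F t))\<^sup>2 \<partial>torus_measure)"
proof -
  let ?a = "norm (\<integral>t. F t \<partial>torus_measure)"
  have one: "(\<integral>t. (norm (1::complex))\<^sup>2 \<partial>torus_measure) = 1"
  proof -
    have "complex_of_real (measure torus_measure (space torus_measure)) = 1"
      using integral_character[of 0] by (simp add: scaleR_conv_of_real)
    then show ?thesis by simp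
  qed
  show ?thesis
  proof (cases "?a = 0")
    case False
    then have "?a > 0" by simp
    have "?a \<le> ((1 / ?a) * (\<integral>t. (norm (F t))\<^sup>2 \<partial>torus_measure) + 1 / (1 / ?a)) / 2"
      using norm_integral_mult_le[OF F spectral_L2[OF spectral_const[of 1]], of "1 / ?a"] \<open>?a > 0\<close> one by simp
    then show ?thesis using \<open>?a > 0\<close>
      by (simp add: field_simps power2_eq_square)
  qed simp
qed

text \<open>Invariance of the measure makes the bound independent of \<open>A\<close>, which is what allows approximating
the functions before letting the matrices vary.\<close>
lemma time_correlation_bound:
  assumes A: "A \<in> SL2Z" and F: "F \<in> L2_torus" and G: "G \<in> L2_torus" and d: "d > 0"
  shows "norm (time_correlation F G A)
    \<le> d * (\<integral>t. (norm (F t))\<^sup>2 \<partial>torus_measure) + (\<integral>t. (norm (G t))\<^sup>2 \<partial>torus_measure) / d"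
proof -
  let ?f = "\<integral>t. (norm (F t))\<^sup>2 \<partial>torus_measure" and ?g = "\<integral>t. (norm (G t))\<^sup>2 \<partial>torus_measure"
  let ?a = "norm (\<integral>t. F t \<partial>torus_measure)" and ?b = "norm (\<integral>t. G t \<partial>torus_measure)"
  have "(\<integral>t. (norm (F (torus_act A t)))\<^sup>2 \<partial>torus_measure) = ?f"
    using integral_torus_act[OF A, of "\<lambda>t. (norm (F t))\<^sup>2"] L2D(1)[OF F] by simp
  then have 1: "norm (\<integral>t. F (torus_act A t) * G t \<partial>torus_measure) \<le> (d * ?f + ?g / d) / 2"
    using norm_integral_mult_le[OF L2_torus_act[OF A F] G d] by simp
  have "2 * (?a * ?b) \<le> d * ?a\<^sup>2 + ?b\<^sup>2 / d"
  proof -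
    have "0 \<le> (d * ?a - ?b)\<^sup>2 / d" using d by simp
    also have "\<dots> = d * ?a\<^sup>2 + ?b\<^sup>2 / d - 2 * (?a * ?b)"
      using d by (simp add: power2_eq_square field_simps)
    finally show ?thesis by simp
  qed
  also have "\<dots> \<le> d * ?f + ?g / d"
    using d norm_integral_square_le[OF F] norm_integral_square_le[OF G]
    by (intro add_mono mult_left_mono divide_right_mono) auto
  finally have 2: "?a * ?b \<le> (d * ?f + ?g / d) / 2" by simp
  have "norm (time_correlation F G A) \<le> norm (\<integral>t. F (torus_act A t) * G t \<partial>torus_measure) + ?a * ?b"
    unfolding time_correlation_def by (rule order_trans[OF norm_triangle_ineq4]) (simp add: norm_mult)
  also have "\<dots> \<le> (d * ?f + ?g / d) / 2 + (d * ?f + ?g / d) / 2"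
    using 1 2 by (rule add_mono)
  also have "\<dots> = d * ?f + ?g / d"
    by (rule field_sum_of_halves)
  finally show ?thesis .
qed

lemma time_correlation_diff_left:
  assumes A: "A \<in> SL2Z" and "F \<in> L2_torus" "F' \<in> L2_torus" "G \<in> L2_torus"
  shows "time_correlation (\<lambda>t. F t - F' t) G A = time_correlation F G A - time_correlation F' G A"
  using assms unfolding time_correlation_def
  by (simp add: left_diff_distrib L2_mult_integrable L2_torus_act[OF A] L2_integrable)

lemma time_correlation_diff_right:
  assumes A: "A \<in> SL2Z" and "F \<in> L2_torus" "G' \<in> L2_torus" "G \<in> L2_torus"
  shows "time_correlation F (\<lambda>t. G t - G' t) A = time_correlation F G A - time_correlation F G' A"
  using assms unfolding time_correlation_def
  by (simp add: right_diff_distrib L2_mult_integrable L2_torus_act[OF A] L2_integrable)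

text \<open>The form of the \<open>\<epsilon>/2\<close> argument that fits the weighted bound: a large weight \<open>d\<close> makes the second
term small, after which \<open>k\<close> makes the first one small, uniformly in \<open>n\<close>.\<close>
lemma tendsto_0_of_uniform_approximation:
  fixes c :: "nat \<Rightarrow> complex" and e :: "nat \<Rightarrow> real"
  assumes e: "e \<longlonglongrightarrow> 0" and M: "M \<ge> 0"
    and approx: "\<And>d k n. d > 0 \<Longrightarrow> norm (c n - c' k n) \<le> d * e k + M / d"
    and lim: "\<And>k. c' k \<longlonglongrightarrow> 0"
  shows "c \<longlonglongrightarrow> 0"
proof (rule LIMSEQ_I)
  fix r :: real assume r: "r > 0"
  define d where "d = 4 * (M + 1) / r"
  have d: "d > 0" using r M by (simp add: d_def)
  have Md: "M / d \<le> r / 4"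
    using r M by (simp add: d_def field_simps)
  have "\<forall>\<^sub>F k in sequentially. e k < r / (4 * d)"
    using e r d by (intro order_tendstoD) auto
  then obtain k where "e k < r / (4 * d)"
    using eventually_happens by fastforce
  then have "d * e k < r / 4"
    using d by (simp add: field_simps)
  then have close: "norm (c n - c' k n) < r / 2" for n
    using approx[OF d, of n k] Md by linarith
  obtain N where "\<forall>n\<ge>N. norm (c' k n - 0) < r / 2"
    using LIMSEQ_D[OF lim[of k], of "r / 2"] r by auto
  then have "norm (c n - 0) < r" if "n \<ge> N" for n
    using close[of n] that norm_triangle_sub[of "c n" "c' k n"] by fastforce
  then show "\<exists>N. \<forall>n\<ge>N. norm (c n - 0) < r" by blast
qed

lemma correlation_limit_left:
  assumes A: "\<And>n. A n \<in> SL2Z" and F: "F \<in> L2_torus" and Fk: "\<And>k. F' k \<in> L2_torus" and G: "G \<in> L2_torus"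
    and conv: "(\<lambda>k. \<integral>t. (norm (F t - F' k t))\<^sup>2 \<partial>torus_measure) \<longlonglongrightarrow> 0"
    and lim: "\<And>k. (\<lambda>n. time_correlation (F' k) G (A n)) \<longlonglongrightarrow> 0"
  shows "(\<lambda>n. time_correlation F G (A n)) \<longlonglongrightarrow> 0"
proof (rule tendsto_0_of_uniform_approximation[OF conv _ _ lim])
  show "0 \<le> (\<integral>t. (norm (G t))\<^sup>2 \<partial>torus_measure)" by simp
  fix d :: real and k n assume "d > 0"
  then show "norm (time_correlation F G (A n) - time_correlation (F' k) G (A n))
      \<le> d * (\<integral>t. (norm (F t - F' k t))\<^sup>2 \<partial>torus_measure) + (\<integral>t. (norm (G t))\<^sup>2 \<partial>torus_measure) / d"
    using time_correlation_bound[OF A L2_diff[OF F Fk] G]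
    by (simp add: time_correlation_diff_left[OF A F Fk G])
qed

lemma correlation_limit_right:
  assumes A: "\<And>n. A n \<in> SL2Z" and F: "F \<in> L2_torus" and Fk: "\<And>k. F' k \<in> L2_torus" and G: "G \<in> L2_torus"
    and conv: "(\<lambda>k. \<integral>t. (norm (F t - F' k t))\<^sup>2 \<partial>torus_measure) \<longlonglongrightarrow> 0"
    and lim: "\<And>k. (\<lambda>n. time_correlation G (F' k) (A n)) \<longlonglongrightarrow> 0"
  shows "(\<lambda>n. time_correlation G F (A n)) \<longlonglongrightarrow> 0"
proof (rule tendsto_0_of_uniform_approximation[OF conv _ _ lim])
  show "0 \<le> (\<integral>t. (norm (G t))\<^sup>2 \<partial>torus_measure)" by simp
  fix d :: real and k n assume "d > 0"
  then show "norm (time_correlation G F (A n) - time_correlation G (F' k) (A n))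
      \<le> d * (\<integral>t. (norm (F t - F' k t))\<^sup>2 \<partial>torus_measure) + (\<integral>t. (norm (G t))\<^sup>2 \<partial>torus_measure) / d"
    using time_correlation_bound[OF A G L2_diff[OF F Fk], of "1 / d"]
    by (simp add: time_correlation_diff_right[OF A G Fk F] add.commute mult.commute)
qed

lemma bounded_convergence_L2:
  assumes "\<And>n. spectral (G n)" "\<And>n t. norm (G n t) \<le> B" "\<And>t. (\<lambda>n. G n t) \<longlonglongrightarrow> F t"
  shows "(\<lambda>n. \<integral>t. (norm (F t - G n t))\<^sup>2 \<partial>torus_measure) \<longlonglongrightarrow> 0"
proof -
  note m = spectral_measurable[OF assms(1)]
  note mF = borel_measurable_LIMSEQ_metric[OF m assms(3)]
  have FB: "norm (F t) \<le> B" for t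
    by (rule Lim_bounded[OF tendsto_norm[OF assms(3)], of 0]) (use assms(2) in simp)
  have "(\<lambda>n. \<integral>t. (norm (F t - G n t))\<^sup>2 \<partial>torus_measure) \<longlonglongrightarrow> (\<integral>t. (0::real) \<partial>torus_measure)"
  proof (rule integral_dominated_convergence[where w = "\<lambda>_. (2 * B)\<^sup>2"])
    show "AE t in torus_measure. (\<lambda>n. (norm (F t - G n t))\<^sup>2) \<longlonglongrightarrow> 0"
    proof (rule AE_I2)
      fix t
      have "(\<lambda>n. (norm (F t - G n t))\<^sup>2) \<longlonglongrightarrow> (norm (F t - F t))\<^sup>2"
        by (intro tendsto_intros assms)
      then show "(\<lambda>n. (norm (F t - G n t))\<^sup>2) \<longlonglongrightarrow> 0" by simp
    qed
    show "AE t in torus_measure. norm ((norm (F t - G n t))\<^sup>2) \<le> (2 * B)\<^sup>2" for n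
    proof (rule AE_I2)
      fix t
      have "norm (F t - G n t) \<le> 2 * B"
        using norm_triangle_ineq4[of "F t" "G n t"] FB[of t] assms(2)[of n t] by linarith
      then show "norm ((norm (F t - G n t))\<^sup>2) \<le> (2 * B)\<^sup>2"
        using power_mono[of "norm (F t - G n t)" "2 * B" 2] by simp
    qed
  qed (use m mF in auto)
  then show ?thesis by simp
qed

lemma L2_truncation:
  assumes F: "F \<in> L2_torus"
  shows "\<exists>F'. (\<forall>k. spectral (F' k)) \<and> (\<lambda>k. \<integral>t. (norm (F t - F' k t))\<^sup>2 \<partial>torus_measure) \<longlonglongrightarrow> 0"
proof (rule exI, rule conjI)
  let ?F = "\<lambda>(k::nat) t. if norm (F t) \<le> k then F t else 0"
  have [measurable]: "F \<in> borel_measurable torus_measure" using L2D(1)[OF F] .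
  show "\<forall>k. spectral (?F k)"
  proof
    show "spectral (?F k)" for k
      by (rule spectral_bounded_measurable[where B = k]) auto
  qed
  have "(\<lambda>k. \<integral>t. (norm (F t - ?F k t))\<^sup>2 \<partial>torus_measure) \<longlonglongrightarrow> (\<integral>t. (0::real) \<partial>torus_measure)"
  proof (rule integral_dominated_convergence[where w = "\<lambda>t. (norm (F t))\<^sup>2"])
    show "AE t in torus_measure. (\<lambda>k. (norm (F t - ?F k t))\<^sup>2) \<longlonglongrightarrow> 0"
    proof (rule AE_I2)
      fix t
      obtain N :: nat where "norm (F t) \<le> real N" using real_arch_simple by blast
      then have "\<forall>\<^sub>F k in sequentially. (norm (F t - ?F k t))\<^sup>2 = 0"
        unfolding eventually_sequentially by (intro exI[of _ N]) auto
      then show "(\<lambda>k. (norm (F t - ?F k t))\<^sup>2) \<longlonglongrightarrow> 0"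
        by (rule tendsto_eventually)
    qed
  qed (use L2D(2)[OF F] in auto)
  then show "(\<lambda>k. \<integral>t. (norm (F t - ?F k t))\<^sup>2 \<partial>torus_measure) \<longlonglongrightarrow> 0"
    by simp
qed

section \<open>A mixing criterion\<close>

lemma time_correlation_characters:
  "time_correlation (character v) (character w) A =
     (if transpose A *v v + w = 0 then 1 else 0) - (if v = 0 \<and> w = 0 then 1 else 0)"
  unfolding time_correlation_def character_torus_act
  by (simp add: integral_character flip: character_add)

text \<open>The hypothesis says that the correlation of two characters eventually vanishes. The class of functions
is then enlarged one argument at a time, from characters to bounded and to square integrable functions.\<close>
proposition mixing_criterion:
  assumes A: "\<And>n. A n \<in> SL2Z"
    and escape: "\<And>v w. v \<noteq> 0 \<Longrightarrow> \<forall>\<^sub>F n in sequentially. transpose (A n) *v v \<noteq> w"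
  shows "mixing A"
proof -
  have cc: "(\<lambda>n. time_correlation (character v) (character w) (A n)) \<longlonglongrightarrow> 0" for v w
  proof (cases "v = 0")
    case True
    then show ?thesis by (simp add: time_correlation_characters)
  next
    case False
    have "\<forall>\<^sub>F n in sequentially. time_correlation (character v) (character w) (A n) = 0"
      using escape[OF False, of "- w"]
      by eventually_elim (auto simp: time_correlation_characters False eq_neg_iff_add_eq_0)
    then show ?thesis by (rule tendsto_eventually)
  qed
  have add_minus: "(\<lambda>t. F t + G t) = (\<lambda>t. F t - - 1 * G t)" for F G :: "torus \<Rightarrow> complex" by simp
  have sc: "(\<lambda>n. time_correlation F (character w) (A n)) \<longlonglongrightarrow> 0" if "spectral F" for F w
    using that
  proof (induction rule: spectral.induct)
    case (char v)
    show ?case by (rule cc)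
  next
    case (scale F c)
    have "(\<lambda>n. c * time_correlation F (character w) (A n)) \<longlonglongrightarrow> c * 0"
      by (intro tendsto_intros scale.IH)
    then show ?case
      by (simp add: time_correlation_def mult.assoc right_diff_distrib)
  next
    case (add F G)
    have "time_correlation (\<lambda>t. F t + G t) (character w) (A n)
        = time_correlation F (character w) (A n) + time_correlation G (character w) (A n)" for n
      using time_correlation_diff_left[OF A[of n], of "\<lambda>t. F t + G t" G "character w"]
        spectral_L2[OF spectral.add[OF add.hyps]] spectral_L2[OF add.hyps(2)] spectral_L2[OF spectral.char]
      by simp
    then show ?case using tendsto_add[OF add.IH] by simp
  next
    case (lim G B F)
    show ?case
      by (rule correlation_limit_left[OF A _ spectral_L2[OF lim.hyps(1)] spectral_L2[OF spectral.char]
            bounded_convergence_L2[OF lim.hyps] lim.IH])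
        (rule spectral_L2[OF spectral.lim[OF lim.hyps]])
  qed
  have ss: "(\<lambda>n. time_correlation F G (A n)) \<longlonglongrightarrow> 0" if F: "spectral F" and "spectral G" for F G
    using that(2)
  proof (induction rule: spectral.induct)
    case (char v)
    show ?case by (rule sc[OF F])
  next
    case (scale G c)
    have "(\<lambda>n. c * time_correlation F G (A n)) \<longlonglongrightarrow> c * 0"
      by (intro tendsto_intros scale.IH)
    then show ?case
      by (simp add: time_correlation_def mult.left_commute right_diff_distrib)
  next
    case (add G H)
    have "time_correlation F (\<lambda>t. G t + H t) (A n)
        = time_correlation F G (A n) + time_correlation F H (A n)" for n
      using time_correlation_diff_right[OF A[of n], of F H "\<lambda>t. G t + H t"]
        spectral_L2[OF spectral.add[OF add.hyps]] spectral_L2[OF add.hyps(2)] spectral_L2[OF F]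
      by simp
    then show ?case using tendsto_add[OF add.IH] by simp
  next
    case (lim H B G)
    show ?case
      by (rule correlation_limit_right[OF A _ spectral_L2[OF lim.hyps(1)] spectral_L2[OF F]
            bounded_convergence_L2[OF lim.hyps] lim.IH])
        (rule spectral_L2[OF spectral.lim[OF lim.hyps]])
  qed
  have ls: "(\<lambda>n. time_correlation F G (A n)) \<longlonglongrightarrow> 0" if F: "F \<in> L2_torus" and G: "spectral G" for F G
  proof -
    obtain F' where "\<forall>k. spectral (F' k)" "(\<lambda>k. \<integral>t. (norm (F t - F' k t))\<^sup>2 \<partial>torus_measure) \<longlonglongrightarrow> 0"
      using L2_truncation[OF F] by blast
    then show ?thesis
      using F G A ss by (intro correlation_limit_left[of A F F' G]) (auto intro: spectral_L2)
  qed
  have "(\<lambda>n. time_correlation F G (A n)) \<longlonglongrightarrow> 0" if F: "F \<in> L2_torus" and G: "G \<in> L2_torus" for F G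
  proof -
    obtain G' where "\<forall>k. spectral (G' k)" "(\<lambda>k. \<integral>t. (norm (G t - G' k t))\<^sup>2 \<partial>torus_measure) \<longlonglongrightarrow> 0"
      using L2_truncation[OF G] by blast
    then show ?thesis
      using F G A ls by (intro correlation_limit_right[of A G G' F]) (auto intro: spectral_L2)
  qed
  then show ?thesis unfolding mixing_def by blast
qed

section \<open>Stable mixing\<close>

text \<open>A matrix fixing a nonzero vector has eigenvalue 1, and determinant 1 forces the other one to be 1.\<close>
lemma trace_of_fixed_vector:
  fixes v :: "int^2"
  assumes "B \<in> SL2Z" "transpose B *v v = v" "v \<noteq> 0"
  shows "trace B = 2"
proof -
  let ?a = "B $ 1 $ 1" and ?b = "B $ 1 $ 2" and ?c = "B $ 2 $ 1" and ?d = "B $ 2 $ 2"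
  have eqs: "?a * v $ 1 + ?c * v $ 2 = v $ 1" "?b * v $ 1 + ?d * v $ 2 = v $ 2"
    using arg_cong[OF assms(2), of "\<lambda>u. u $ 1"] arg_cong[OF assms(2), of "\<lambda>u. u $ 2"]
    by (simp_all add: matrix_vector_mult_def sum_2)
  have det: "?a * ?d - ?b * ?c = 1"
    using assms(1) by (simp add: SL2Z_iff)
  have "(2 - ?a - ?d) * v $ 1 = (?d - 1) * (?a * v $ 1 + ?c * v $ 2 - v $ 1)
      - ?c * (?b * v $ 1 + ?d * v $ 2 - v $ 2) + (1 - (?a * ?d - ?b * ?c)) * v $ 1"
    by (simp add: algebra_simps)
  also have "\<dots> = 0"
    unfolding eqs det by simp
  finally have "(2 - ?a - ?d) * v $ 1 = 0" .
  moreover have "(2 - ?a - ?d) * v $ 2 = (?a - 1) * (?b * v $ 1 + ?d * v $ 2 - v $ 2)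
      - ?b * (?a * v $ 1 + ?c * v $ 2 - v $ 1) + (1 - (?a * ?d - ?b * ?c)) * v $ 2"
    by (simp add: algebra_simps)
  then have "(2 - ?a - ?d) * v $ 2 = 0"
    unfolding eqs det by simp
  ultimately have "2 - ?a - ?d = 0"
    using assms(3) by (auto simp: vec_eq_iff forall_2)
  then show ?thesis by (simp add: trace_2)
qed

text \<open>If \<open>A\<close> and \<open>A0\<close> act in the same way on \<open>v\<close>, then the transpose of \<open>A ** matrix_inv A0\<close> fixes \<open>v\<close>.\<close>
lemma quasimorphism_bounded_on_transporter:
  fixes q :: "int^2^2 \<Rightarrow> int"
  assumes quasi: "\<And>A B. A \<in> SL2Z \<Longrightarrow> B \<in> SL2Z \<Longrightarrow> \<bar>q (A ** B) - q A - q B\<bar> \<le> K"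
    and bounded: "\<And>A. A \<in> SL2Z \<Longrightarrow> \<bar>trace A\<bar> \<le> 2 \<Longrightarrow> \<bar>q A\<bar> \<le> N"
    and v: "v \<noteq> (0 :: int^2)"
  shows "\<exists>N'. \<forall>A\<in>SL2Z. transpose A *v v = w \<longrightarrow> \<bar>q A\<bar> \<le> N'"
proof (cases "\<exists>A\<in>SL2Z. transpose A *v v = w")
  case True
  then obtain A0 where A0: "A0 \<in> SL2Z" "transpose A0 *v v = w" by blast
  have "\<bar>q A\<bar> \<le> N + K + \<bar>q A0\<bar>" if A: "A \<in> SL2Z" "transpose A *v v = w" for A
  proof -
    let ?B = "A ** matrix_inv A0"
    have B: "?B \<in> SL2Z" using A A0 by auto
    have "transpose ?B *v v = transpose (matrix_inv A0) *v (transpose A0 *v v)"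
      unfolding A0(2) A(2)[symmetric] by (simp only: matrix_transpose_mul matrix_vector_mul_assoc)
    also have "\<dots> = transpose (A0 ** matrix_inv A0) *v v"
      by (simp only: matrix_transpose_mul matrix_vector_mul_assoc)
    also have "\<dots> = v" using A0 by (simp add: transpose_mat)
    finally have "trace ?B = 2"
      using trace_of_fixed_vector[OF B _ v] by blast
    then have "\<bar>q ?B\<bar> \<le> N" using bounded[OF B] by simp
    moreover have "?B ** A0 = A" using A0 by (simp flip: matrix_mul_assoc)
    ultimately show ?thesis
      using quasi[OF B A0(1)] by simp
  qed
  then show ?thesis by blast
qed blast

lemma kicked_system_SL2Z:
  assumes "h \<in> SL2Z" "\<And>i. i \<ge> 1 \<Longrightarrow> \<phi> i \<in> SL2Z"
  shows "kicked_system \<phi> h t n \<in> SL2Z"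
  using assms by (induction n) (auto intro!: SL2Z_mult)

proposition stably_mixing_if_not_conjugate_inverse:
  assumes h: "h \<in> SL2Z" "hyperbolic h" and nc: "\<not> conjugate_SL2Z h (matrix_inv h)"
  shows "stably_mixing h"
  unfolding stably_mixing_def
proof (intro allI impI)
  fix \<phi> :: "nat \<Rightarrow> int^2^2"
  assume \<phi>: "(\<forall>i\<ge>1. \<phi> i \<in> SL2Z) \<and> (\<exists>B. \<forall>i\<ge>1. \<bar>trace (\<phi> i)\<bar> \<le> B)"
  then obtain T where T: "\<And>i. i \<ge> 1 \<Longrightarrow> \<bar>trace (\<phi> i)\<bar> \<le> T" by blast
  obtain q :: "int^2^2 \<Rightarrow> int" and K where
    quasi: "\<And>A B. A \<in> SL2Z \<Longrightarrow> B \<in> SL2Z \<Longrightarrow> \<bar>q (A ** B) - q A - q B\<bar> \<le> K"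
    and bounded: "\<And>T. \<exists>N. \<forall>A\<in>SL2Z. \<bar>trace A\<bar> \<le> T \<longrightarrow> \<bar>q A\<bar> \<le> N"
    and growth: "\<And>t. q (mat_pow h t) \<ge> int t - K"
    using ex_quasimorphism[OF h nc] by blast
  obtain N where N: "\<And>i. i \<ge> 1 \<Longrightarrow> \<bar>q (\<phi> i)\<bar> \<le> N"
    using bounded[of T] T \<phi> by blast
  show "\<exists>t0. \<forall>t>t0. mixing (kicked_system \<phi> h t)"
  proof (intro exI allI impI)
    \<comment> \<open>Each step loses at most \<open>N\<close> to the kick and \<open>2 * K\<close> to two products; the remaining \<open>K\<close> is the loss in the growth of \<open>q\<close> along the powers of \<open>h\<close>.\<close>
    fix t assume t: "t > nat (N + 3 * K)"
    let ?f = "kicked_system \<phi> h t"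
    have f: "?f n \<in> SL2Z" for n
      using kicked_system_SL2Z h \<phi> by blast
    have drift: "q (?f n) \<ge> q (mat 1) + int n" for n
    proof (induction n)
      case (Suc n)
      have S: "\<phi> (Suc n) \<in> SL2Z" "mat_pow h t \<in> SL2Z" using \<phi> h by auto
      have "q (?f (Suc n)) \<ge> q (\<phi> (Suc n) ** mat_pow h t) + q (?f n) - K"
        using quasi[OF SL2Z_mult[OF S] f[of n]] by simp
      moreover have "q (\<phi> (Suc n) ** mat_pow h t) \<ge> q (\<phi> (Suc n)) + q (mat_pow h t) - K"
        using quasi[OF S] by simp
      moreover have "q (\<phi> (Suc n)) \<ge> - N" using N[of "Suc n"] by simp
      moreover have "int t \<ge> N + 3 * K + 1" using t by linarith
      ultimately show ?case using Suc growth[of t] by simp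
    qed simp
    show "mixing ?f"
    proof (rule mixing_criterion[OF f])
      fix v w :: "int^2" assume v: "v \<noteq> 0"
      obtain N2 where "\<forall>A\<in>SL2Z. \<bar>trace A\<bar> \<le> 2 \<longrightarrow> \<bar>q A\<bar> \<le> N2" using bounded by blast
      then obtain N' where N': "\<And>A. A \<in> SL2Z \<Longrightarrow> transpose A *v v = w \<Longrightarrow> \<bar>q A\<bar> \<le> N'"
        using quasimorphism_bounded_on_transporter[OF quasi _ v, of N2 w] by blast
      have "transpose (?f n) *v v \<noteq> w" if "n > nat (N' - q (mat 1))" for n
        using N'[OF f[of n]] drift[of n] that by auto
      then show "\<forall>\<^sub>F n in sequentially. transpose (?f n) *v v \<noteq> w"
        unfolding eventually_sequentially by (meson Suc_le_eq)
    qed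
  qed
qed

text \<open>The witness is a nontrivial character against its conjugate: their correlation at the identity is 1.\<close>
lemma not_mixing_if_recurrent:
  assumes "\<exists>\<^sub>F n in sequentially. f n = mat 1"
  shows "\<not> mixing f"
proof
  assume "mixing f"
  define v :: "int^2" where "v = axis 1 1"
  have v: "v \<noteq> 0" by (simp add: v_def axis_eq_0_iff)
  have "(\<lambda>n. time_correlation (character v) (character (- v)) (f n)) \<longlonglongrightarrow> 0"
    using \<open>mixing f\<close> spectral_L2[OF spectral.char] unfolding mixing_def by blast
  then have "\<forall>\<^sub>F n in sequentially. norm (time_correlation (character v) (character (- v)) (f n)) < 1"
    using order_tendstoD(2)[OF tendsto_norm, of _ 0 _ 1] by fastforce
  with assms have "\<exists>\<^sub>F n in sequentially. norm (time_correlation (character v) (character (- v)) (f n)) < 1 \<and> f n = mat 1"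
    by (rule frequently_eventually_conj)
  moreover have "time_correlation (character v) (character (- v)) (mat 1) = 1"
    using v by (simp add: time_correlation_characters transpose_mat)
  ultimately show False
    by (auto dest!: frequently_ex)
qed

proposition not_stably_mixing_if_conjugate_inverse:
  assumes h: "h \<in> SL2Z" and conj: "conjugate_SL2Z h (matrix_inv h)"
  shows "\<not> stably_mixing h"
proof
  assume "stably_mixing h"
  obtain g where g: "g \<in> SL2Z" "g ** h ** matrix_inv g = matrix_inv h"
    using conj unfolding conjugate_SL2Z_def by blast
  \<comment> \<open>Kicks are indexed from 1, so the first one is \<open>matrix_inv g\<close>.\<close>
  define \<phi> :: "nat \<Rightarrow> int^2^2" where "\<phi> i = (if odd i then matrix_inv g else g)" for i
  have "\<phi> i \<in> SL2Z" "\<bar>trace (\<phi> i)\<bar> \<le> max \<bar>trace g\<bar> \<bar>trace (matrix_inv g)\<bar>" for i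
    using g(1) by (auto simp: \<phi>_def)
  then obtain t0 where t0: "\<forall>t>t0. mixing (kicked_system \<phi> h t)"
    using \<open>stably_mixing h\<close> unfolding stably_mixing_def by blast
  have inv: "g ** mat_pow h t ** matrix_inv g ** mat_pow h t = mat 1" for t
  proof (induction t)
    case 0
    then show ?case using g(1) by simp
  next
    case (Suc t)
    have comm: "mat_pow h t ** h = h ** mat_pow h t"
      by (induction t) (simp_all flip: matrix_mul_assoc)
    have "g ** mat_pow h (Suc t) ** matrix_inv g ** mat_pow h (Suc t)
        = g ** mat_pow h t ** matrix_inv g ** (g ** h ** matrix_inv g) ** h ** mat_pow h t"
      using g(1) by (simp add: comm[symmetric] flip: matrix_mul_assoc)
    also have "\<dots> = g ** mat_pow h t ** matrix_inv g ** mat_pow h t"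
      unfolding g(2) using h by (simp flip: matrix_mul_assoc)
    finally show ?case using Suc.IH by simp
  qed
  have "kicked_system \<phi> h t (2 * n) = mat 1" for t n
  proof (induction n)
    case (Suc n)
    have "kicked_system \<phi> h t (2 * Suc n)
        = (g ** mat_pow h t ** matrix_inv g ** mat_pow h t) ** kicked_system \<phi> h t (2 * n)"
      by (simp add: \<phi>_def matrix_mul_assoc)
    then show ?case using Suc.IH by (simp add: inv)
  qed simp
  then have "\<exists>\<^sub>F n in sequentially. kicked_system \<phi> h t n = mat 1" for t
    unfolding frequently_sequentially by (metis le_add1 mult_2)
  then show False
    using t0 not_mixing_if_recurrent by blast
qed

theorem theorem2:
  fixes h :: "int^2^2"
  assumes "h \<in> SL2Z" and "hyperbolic h"
  shows "stably_mixing h \<longleftrightarrow> \<not> conjugate_SL2Z h (matrix_inv h)"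
  using stably_mixing_if_not_conjugate_inverse not_stably_mixing_if_conjugate_inverse assms by blast

end
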